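(* Suppose the strong invariance assumption (SI) stated in the context holds, and that $\beta=\lim_{n\to\infty} m_n/n\in(0,1)$. Assume also that $b_n\to b_\infty\in\{2,3,\ldots,\infty\}$ as $n\to\infty$. Let $\kappa_1(\beta,b_\infty)=1-\beta$, let $\{W(t),t\ge 0\}$ be a standard Wiener process, let $c_j:=(j-1)\frac{1-\beta}{b_\infty-1}$ for $j=1,\ldots,b_\infty$ when $b_\infty<\infty$, and define $$\chi^2_{\mathrm{OB\text{-}I}}(\beta,b_\infty):=\begin{cases}\dfrac{1}{\kappa_1(\beta,b_\infty)}\dfrac{1}{\beta(1-\beta)}\displaystyle\int_0^{1-\beta}\bigl(W(u+\beta)-W(u)-\beta W(1)\bigr)^2\,du, & b_\infty=\infty,\\[2ex] \dfrac{1}{\kappa_1(\beta,b_\infty)}\dfrac{1}{\beta b_\infty}\displaystyle\sum_{j=1}^{b_\infty}\bigl(W(c_j+\beta)-W(c_j)-\beta W(1)\bigr)^2, & b_\infty\in\mathbb{N}\setminus\{1\}.\end{cases}$$ Then, as $n\to\infty$, $$\hat\sigma^2_{\mathrm{OB\text{-}I}}(m_n,b_n)\ \xrightarrow{d}\ \sigma^2\chi^2_{\mathrm{OB\text{-}I}}(\beta,b_\infty)\qquad\text{and}\qquad T_{\mathrm{OB\text{-}I}}(m_n,b_n)\ \xrightarrow{d}\ \frac{W(1)}{\sqrt{\chi^2_{\mathrm{OB\text{-}I}}(\beta,b_\infty)}},$$ where in the last limit the numerator and the denominator are built from the same Wiener process $W$.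
   Context: **Setting.** $\{X_j,j\ge1\}$ is an $S$-valued discrete-time stationary process with distribution $P$, and $\theta(P)\in\mathbb{R}$ is the value at $P$ of a real-valued statistical functional. There is a fixed estimation rule which, from any batch $X_\ell,X_{\ell+1},\ldots,X_u$ of consecutive observations, constructs a real-valued point estimator $\hat\theta(\{X_j,\ell\le j\le u\})$ of $\theta(P)$ (for example the plug-in estimator, i.e. $\theta$ evaluated at the empirical measure of the batch). **Batches.** For each $n$, the data $X_1,\ldots,X_n$ are divided into $b_n$ possibly overlapping batches, each of size $m_n$, with offset $d_n\ge1$. Batch $i$ consists of $X_{(i-1)d_n+1},\ldots,X_{(i-1)d_n+m_n}$, $i=1,\ldots,b_n$, and $d_n=(n-m_n)/(b_n-1)$ ($m_n,d_n,b_n$ are positive integers). **Estimators.** $\hat\theta_n:=\hat\theta(\{X_j,1\le j\le n\})$ is the sectioning estimator, and $\hat\theta_{i,m_n}:=\hat\theta(\{X_j,(i-1)d_n+1\le j\le (i-1)d_n+m_n\})$ is the estimator from batch $i$. The asymptotic variance parameter is $\sigma^2:=\lim_{n\to\infty}\mathbb{E}[(\sqrt n(\hat\theta_n-\theta(P)))^2]$, assumed to exist, with $\sigma\in(0,\infty)$. With $\beta=\lim_n m_n/n$, define $$\hat\sigma^2_{\mathrm{OB\text{-}I}}(m_n,b_n):=\frac{1}{1-\beta}\,\frac{m_n}{b_n}\sum_{i=1}^{b_n}(\hat\theta_{i,m_n}-\hat\theta_n)^2,\qquad T_{\mathrm{OB\text{-}I}}(m_n,b_n):=\frac{\sqrt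 n(\hat\theta_n-\theta(P))}{\hat\sigma_{\mathrm{OB\text{-}I}}(m_n,b_n)},$$ where $\hat\sigma_{\mathrm{OB\text{-}I}}$ is the nonnegative square root of $\hat\sigma^2_{\mathrm{OB\text{-}I}}$. **Assumption (SI) (strong invariance).** The sequence $\{\hat\theta_n,n\ge1\}$ satisfies the following. There exist a standard Wiener process $\{W(t),t\ge0\}$ and a stationary process $\{\tilde X_n,n\ge1\}$ with the same distribution as $\{X_n,n\ge1\}$, defined on a common probability space, such that as $n\to\infty$, $$\left|\sigma^{-1}\bigl(\hat\theta_{\lfloor n\rfloor}-\theta(P)\bigr)-n^{-1}W(n)\right|\le\Gamma\,n^{-1/2-\delta}\sqrt{\log n}\quad\text{a.s.},$$ where $\delta>0$ is a constant and $\Gamma$ is a real-valued random variable with $\mathbb{E}[\Gamma]<\infty$ (on this probability space the estimators are computed from $\{\tilde X_n\}$). $\xrightarrow{d}$ denotes convergence in distribution.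
   Formalization: Assumption (SI) is strengthened: the bound is required for the estimator of every batch of length m with offset at most K·m (any fixed K), against the increment of W over that batch, not only for the first n observations; with the latter alone the claim fails for general estimation rules. *)

theory Defs
  imports "HOL-Probability.Probability"
begin

section \<open>Processes\<close>

text \<open>Time runs over \<open>1, 2, 3, \<dots>\<close>; the value \<open>X 0\<close> is never used.\<close>

definition process_law :: "'a measure \<Rightarrow> 's measure \<Rightarrow> (nat \<Rightarrow> 'a \<Rightarrow> 's) \<Rightarrow> (nat \<Rightarrow> 's) measure" where
  "process_law M S X = distr M (PiM {1..} (\<lambda>_. S)) (\<lambda>\<omega>. \<lambda>j\<in>{1..}. X j \<omega>)"

definition stationary_process :: "'a measure \<Rightarrow> 's measure \<Rightarrow> (nat \<Rightarrow> 'a \<Rightarrow> 's) \<Rightarrow> bool" where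
  "stationary_process M S X \<longleftrightarrow>
     prob_space M \<and> (\<forall>j\<ge>1. X j \<in> measurable M S) \<and>
     (\<forall>k. process_law M S (\<lambda>j. X (j + k)) = process_law M S X)"

text \<open>\<open>W t\<close> is only relevant for \<open>t \<ge> 0\<close>. Every path is continuous, so path integrals of \<open>W\<close>
  are random variables even when \<open>M\<close> is not complete.\<close>

definition standard_wiener :: "'w measure \<Rightarrow> (real \<Rightarrow> 'w \<Rightarrow> real) \<Rightarrow> bool" where
  "standard_wiener M W \<longleftrightarrow>
     prob_space M \<and>
     (\<forall>t\<ge>0. W t \<in> borel_measurable M) \<and>
     (AE \<omega> in M. W 0 \<omega> = 0) \<and>
     (\<forall>\<omega>\<in>space M. continuous_on {0..} (\<lambda>t. W t \<omega>)) \<and>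
     (\<forall>s t. 0 \<le> s \<longrightarrow> s < t \<longrightarrow>
        distributed M lborel (\<lambda>\<omega>. W t \<omega> - W s \<omega>) (normal_density 0 (sqrt (t - s)))) \<and>
     (\<forall>(k::nat) (t :: nat \<Rightarrow> real). 0 \<le> t 0 \<longrightarrow> mono t \<longrightarrow>
        prob_space.indep_vars M (\<lambda>_. borel) (\<lambda>i \<omega>. W (t (Suc i)) \<omega> - W (t i) \<omega>) {..<k})"

section \<open>Batch estimators\<close>

text \<open>An estimation rule maps the list of observations of a batch to a real number; it is a
  measurable function of the batch for every batch size.\<close>

definition estimation_rule :: "'s measure \<Rightarrow> ('s list \<Rightarrow> real) \<Rightarrow> bool" where
  "estimation_rule S est \<longleftrightarrow>
     (\<forall>k\<ge>1. (\<lambda>x. est (map x [0..<k])) \<in> borel_measurable (PiM {..<k} (\<lambda>_. S)))"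

text \<open>The estimator computed from \<open>X\<^sub>l, \<dots>, X\<^sub>u\<close>.\<close>

definition theta_hat :: "('s list \<Rightarrow> real) \<Rightarrow> (nat \<Rightarrow> 'a \<Rightarrow> 's) \<Rightarrow> nat \<Rightarrow> nat \<Rightarrow> 'a \<Rightarrow> real" where
  "theta_hat est X l u \<omega> = est (map (\<lambda>j. X j \<omega>) [l..<u + 1])"

definition sectioning :: "('s list \<Rightarrow> real) \<Rightarrow> (nat \<Rightarrow> 'a \<Rightarrow> 's) \<Rightarrow> nat \<Rightarrow> 'a \<Rightarrow> real" where
  "sectioning est X n = theta_hat est X 1 n"

definition batch_estimator ::
  "('s list \<Rightarrow> real) \<Rightarrow> (nat \<Rightarrow> 'a \<Rightarrow> 's) \<Rightarrow> nat \<Rightarrow> nat \<Rightarrow> nat \<Rightarrow> 'a \<Rightarrow> real" where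
  "batch_estimator est X m d i = theta_hat est X ((i - 1) * d + 1) ((i - 1) * d + m)"

definition sigma2_OB_I ::
  "('s list \<Rightarrow> real) \<Rightarrow> (nat \<Rightarrow> 'a \<Rightarrow> 's) \<Rightarrow> real \<Rightarrow> nat \<Rightarrow> nat \<Rightarrow> nat \<Rightarrow> nat \<Rightarrow> 'a \<Rightarrow> real" where
  "sigma2_OB_I est X \<beta> n m d b \<omega> =
     1 / (1 - \<beta>) * (real m / real b) *
       (\<Sum>i=1..b. (batch_estimator est X m d i \<omega> - sectioning est X n \<omega>)\<^sup>2)"

definition T_OB_I ::
  "('s list \<Rightarrow> real) \<Rightarrow> (nat \<Rightarrow> 'a \<Rightarrow> 's) \<Rightarrow> real \<Rightarrow> real \<Rightarrow> nat \<Rightarrow> nat \<Rightarrow> nat \<Rightarrow> nat \<Rightarrow> 'a \<Rightarrow> real" where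
  "T_OB_I est X \<theta> \<beta> n m d b \<omega> =
     sqrt (real n) * (sectioning est X n \<omega> - \<theta>) / sqrt (sigma2_OB_I est X \<beta> n m d b \<omega>)"

section \<open>Strong invariance\<close>

text \<open>
  The offset \<open>l = 0\<close> (take \<open>K = 0\<close>) is the usual bound for the estimators
  \<open>\<theta>\<^sub>m\<close> based on the first \<open>m\<close> observations,
  \<open>\<bar>(\<theta>\<^sub>m - \<theta>) / \<sigma> - W(m) / m\<bar> \<le> \<Gamma> m powr (-1/2 - \<delta>) sqrt (log m)\<close> for all large \<open>m\<close>.

  The same bound is required of the estimator of each batch of length \<open>m\<close> whose offset is at most
  a fixed multiple of \<open>m\<close>, with the increment of \<open>W\<close> over that batch. For sample means this follows
  from the case \<open>l = 0\<close> (with a smaller \<open>\<delta>\<close>). For a general rule it does not, and the case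
  \<open>l = 0\<close> alone says nothing about batches that do not start at time 1: let the \<open>(s\<^sub>j, x\<^sub>j)\<close> be
  i.i.d., \<open>s\<^sub>j = \<plusminus>1\<close> a fair sign and \<open>x\<^sub>j\<close> an independent standard normal variable, and let the
  estimate of \<open>\<theta> = 0\<close> be the mean of the \<open>x\<^sub>j\<close> of the batch times the sign \<open>s\<^sub>j\<close> of its first
  observation. Then the case \<open>l = 0\<close> holds without error, but the signs of the batches are
  independent, and already for two disjoint half-size batches the batching variance estimator does
  not have the limit obtained from the increments of a single \<open>W\<close>.

  The bound is asked at integer times only, so no floor occurs. As \<open>sqrt (ln m) > 0\<close> for
  \<open>m > 1\<close>, it forces \<open>\<Gamma> \<ge> 0\<close> a.s., and integrability is \<open>E \<Gamma> < \<infinity>\<close>.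
\<close>

definition strong_invariance ::
  "'c measure \<Rightarrow> ('s list \<Rightarrow> real) \<Rightarrow> (nat \<Rightarrow> 'c \<Rightarrow> 's) \<Rightarrow> (real \<Rightarrow> 'c \<Rightarrow> real) \<Rightarrow>
   real \<Rightarrow> real \<Rightarrow> real \<Rightarrow> ('c \<Rightarrow> real) \<Rightarrow> bool" where
  "strong_invariance N est X W \<theta> \<sigma> \<delta> \<Gamma> \<longleftrightarrow>
     \<delta> > 0 \<and> integrable N \<Gamma> \<and>
     (AE \<omega> in N. \<forall>K::nat. \<forall>\<^sub>F m in sequentially. \<forall>l\<le>K * m.
        \<bar>(theta_hat est X (l + 1) (l + m) \<omega> - \<theta>) / \<sigma>
          - (W (real (l + m)) \<omega> - W (real l) \<omega>) / real m\<bar>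
        \<le> \<Gamma> \<omega> * real m powr (- 1/2 - \<delta>) * sqrt (ln (real m)))"

section \<open>The limit\<close>

definition kappa1 :: "real \<Rightarrow> enat \<Rightarrow> real" where
  "kappa1 \<beta> b = 1 - \<beta>"

definition chi2_OB_I :: "(real \<Rightarrow> 'w \<Rightarrow> real) \<Rightarrow> real \<Rightarrow> enat \<Rightarrow> 'w \<Rightarrow> real" where
  "chi2_OB_I W \<beta> b \<omega> =
     (case b of
        \<infinity> \<Rightarrow> 1 / kappa1 \<beta> b * (1 / (\<beta> * (1 - \<beta>))) *
          (LBINT u:{0..1 - \<beta>}. (W (u + \<beta>) \<omega> - W u \<omega> - \<beta> * W 1 \<omega>)\<^sup>2)
      | enat k \<Rightarrow> 1 / kappa1 \<beta> b * (1 / (\<beta> * real k)) *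
          (\<Sum>j=1..k. let c = (real j - 1) * ((1 - \<beta>) / (real k - 1))
                     in (W (c + \<beta>) \<omega> - W c \<omega> - \<beta> * W 1 \<omega>)\<^sup>2))"

end

theory Submission
  imports Defs "HOL-Real_Asymp.Real_Asymp"
begin

text \<open>
  Strong invariance replaces each batch estimator by \<open>\<theta>\<close> plus \<open>\<sigma>\<close> times the mean increment of one Wiener
  process \<open>W'\<close> over the batch, with an error that vanishes almost surely after multiplication by
  \<open>sqrt n\<close>, uniformly over the batches. Hence, on the space of \<open>W'\<close>, the numerator of the studentized
  statistic and the root of the variance estimator differ by a null sequence from the same
  quantities computed for the random walk \<open>W' 0, W' 1, W' 2, \<dots>\<close>
  (\<open>strong_approximation_vanishes\<close>).

  The walk quantities do not converge pathwise, as the time scale grows with \<open>n\<close>. By Brownian scaling, though, their law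
  is that of the same quantities for the walk \<open>sqrt n * W (k / n)\<close>, where \<open>W\<close> is the Wiener process of
  the limit (\<open>standard_wiener_scaling_law\<close>). For this walk they do converge on every path: only
  continuity of the path is used, in the form of convergence of finitely many terms if the number of
  batches stays bounded, and of a Riemann sum if it grows (\<open>walk_sigma2_tendsto_chi2\<close>). Passing from the
  estimators to the walk of \<open>W'\<close>, from there in law to the walk of \<open>W\<close>, and then to the limit, gives weak
  convergence of every linear combination of numerator and denominator (\<open>weak_conv_by_coupling\<close>).

  Convergence of the variance estimator follows from that of its root (\<open>weak_conv_of_sqrt\<close>). For the
  studentized statistic, \<open>U / V \<le> x\<close> is \<open>U - x * V \<le> 0\<close> when \<open>V > 0\<close> (\<open>weak_conv_ratio\<close>), and the limiting
  denominator is almost surely positive because a bridge increment of a Wiener process has a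
  density (\<open>standard_wiener_bridge_nonzero\<close>, \<open>chi2_OB_I_pos\<close>).
\<close>

section \<open>Weak convergence of real random variables\<close>

text \<open>
  The only form of Slutsky's theorem and of Skorokhod representation that is needed. A bounded
  uniformly continuous test function has nearly the same integral along \<open>Z n\<close> and \<open>Z' n\<close>, and exactly the
  same along \<open>Z' n\<close> and \<open>Y n\<close>. The variables \<open>Z' n\<close> need not converge in any sense on their
  own space: only their laws are carried over to \<open>\<Omega>\<close>, where dominated convergence applies.
\<close>
lemma weak_conv_by_coupling:
  fixes Z Z' :: "nat \<Rightarrow> 'a \<Rightarrow> real" and Y :: "nat \<Rightarrow> 'b \<Rightarrow> real" and Y' :: "'b \<Rightarrow> real"
  assumes "prob_space N" "prob_space \<Omega>"
    and [measurable]: "\<And>n. Z n \<in> borel_measurable N" "\<And>n. Z' n \<in> borel_measurable N"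
      "\<And>n. Y n \<in> borel_measurable \<Omega>" "Y' \<in> borel_measurable \<Omega>"
    and law: "\<forall>\<^sub>F n in sequentially. distr N borel (Z' n) = distr \<Omega> borel (Y n)"
    and diff: "AE \<omega> in N. (\<lambda>n. Z n \<omega> - Z' n \<omega>) \<longlonglongrightarrow> 0"
    and lim: "AE \<omega> in \<Omega>. (\<lambda>n. Y n \<omega>) \<longlonglongrightarrow> Y' \<omega>"
  shows "weak_conv_m (\<lambda>n. distr N borel (Z n)) (distr \<Omega> borel Y')"
proof -
  interpret N: prob_space N by fact
  interpret O: prob_space \<Omega> by fact
  show ?thesis
  proof (rule integral_cts_step_conv_imp_weak_conv)
    fix x y :: real assume xy: "x < y"
    let ?g = "cts_step x y"
    have uc: "uniformly_continuous_on UNIV ?g"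
      by (rule cts_step_uniformly_continuous[OF xy])
    have cont: "continuous_on UNIV ?g"
      by (rule uniformly_continuous_imp_continuous[OF uc])
    have [measurable]: "?g \<in> borel_measurable borel"
      by (rule borel_measurable_continuous_onI[OF cont])
    have bnd: "\<bar>?g z\<bar> \<le> 1" for z
      using xy by (auto simp: cts_step_def)
    have intN: "integrable N (\<lambda>\<omega>. ?g (f \<omega>))" if "f \<in> borel_measurable N" for f
      using that by (intro N.integrable_const_bound[of _ 1]) (auto simp: bnd)
    have "(\<lambda>n. \<integral>\<omega>. ?g (Z n \<omega>) - ?g (Z' n \<omega>) \<partial>N) \<longlonglongrightarrow> (\<integral>\<omega>. 0 \<partial>N)"
    proof (rule integral_dominated_convergence[where w = "\<lambda>_. 2"])
      show "AE \<omega> in N. (\<lambda>n. ?g (Z n \<omega>) - ?g (Z' n \<omega>)) \<longlonglongrightarrow> 0"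
        using diff
      proof eventually_elim
        case (elim \<omega>)
        show ?case
        proof (rule metric_LIMSEQ_I)
          fix r :: real assume "0 < r"
          then obtain e where e: "e > 0" "\<And>u v. dist u v < e \<Longrightarrow> dist (?g u) (?g v) < r"
            using uc unfolding uniformly_continuous_on_def by (metis UNIV_I)
          from metric_LIMSEQ_D[OF elim e(1)] obtain n0
            where "\<forall>n\<ge>n0. dist (Z n \<omega> - Z' n \<omega>) 0 < e" by blast
          then show "\<exists>n0. \<forall>n\<ge>n0. dist (?g (Z n \<omega>) - ?g (Z' n \<omega>)) 0 < r"
            using e(2) by (auto simp: dist_real_def)
        qed
      qed
      show "AE \<omega> in N. norm (?g (Z n \<omega>) - ?g (Z' n \<omega>)) \<le> 2" for n
      proof (rule AE_I2)
        fix \<omega>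
        show "norm (?g (Z n \<omega>) - ?g (Z' n \<omega>)) \<le> 2"
          using bnd[of "Z n \<omega>"] bnd[of "Z' n \<omega>"] unfolding real_norm_def by linarith
      qed
    qed auto
    then have "(\<lambda>n. (\<integral>\<omega>. ?g (Z n \<omega>) \<partial>N) - (\<integral>\<omega>. ?g (Z' n \<omega>) \<partial>N)) \<longlonglongrightarrow> 0"
      by (simp add: Bochner_Integration.integral_diff intN)
    moreover have "(\<lambda>n. \<integral>\<omega>. ?g (Y n \<omega>) \<partial>\<Omega>) \<longlonglongrightarrow> (\<integral>\<omega>. ?g (Y' \<omega>) \<partial>\<Omega>)"
    proof (rule integral_dominated_convergence[where w = "\<lambda>_. 1"])
      show "AE \<omega> in \<Omega>. (\<lambda>n. ?g (Y n \<omega>)) \<longlonglongrightarrow> ?g (Y' \<omega>)"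
        using lim
        by eventually_elim (rule continuous_on_tendsto_compose[OF cont], auto)
    qed (auto simp: bnd)
    moreover have "\<forall>\<^sub>F n in sequentially. (\<integral>\<omega>. ?g (Z' n \<omega>) \<partial>N) = (\<integral>\<omega>. ?g (Y n \<omega>) \<partial>\<Omega>)"
      using law
    proof eventually_elim
      case (elim n)
      have "(\<integral>\<omega>. ?g (Z' n \<omega>) \<partial>N) = integral\<^sup>L (distr N borel (Z' n)) ?g"
        by (simp add: integral_distr)
      then show ?case
        unfolding elim by (simp add: integral_distr)
    qed
    ultimately have "(\<lambda>n. \<integral>\<omega>. ?g (Z n \<omega>) \<partial>N) \<longlonglongrightarrow> (\<integral>\<omega>. ?g (Y' \<omega>) \<partial>\<Omega>)"
      using Lim_transform tendsto_cong by fast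
    then show "(\<lambda>n. integral\<^sup>L (distr N borel (Z n)) ?g) \<longlonglongrightarrow> integral\<^sup>L (distr \<Omega> borel Y') ?g"
      by (simp add: integral_distr)
  qed auto
qed

lemma cdf_distr:
  assumes "f \<in> borel_measurable M"
  shows "cdf (distr M borel f) x = measure M {\<omega> \<in> space M. f \<omega> \<le> x}"
  using assms by (auto simp: cdf_def measure_distr intro!: arg_cong[where f = "measure M"])

lemma isCont_cdf_distr:
  assumes "prob_space M" "f \<in> borel_measurable M"
  shows "isCont (cdf (distr M borel f)) x \<longleftrightarrow> measure M {\<omega> \<in> space M. f \<omega> = x} = 0"
proof -
  interpret real_distribution "distr M borel f"
    using assms by (intro prob_space.real_distribution_distr)
  show ?thesis
    unfolding isCont_cdf using assms(2)
    by (auto simp: measure_distr intro!: arg_cong[where f = "\<lambda>A. measure M A = 0"])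
qed

text \<open>
  The square root is an increasing bijection of the reals, since \<open>sqrt (- x) = - sqrt x\<close>, so it only
  relabels the arguments of the distribution functions.
\<close>
lemma weak_conv_of_sqrt:
  assumes "prob_space N" "prob_space \<Omega>"
    and [measurable]: "\<And>n. A n \<in> borel_measurable N" "B \<in> borel_measurable \<Omega>"
    and conv: "weak_conv_m (\<lambda>n. distr N borel (\<lambda>\<omega>. sqrt (A n \<omega>))) (distr \<Omega> borel (\<lambda>\<omega>. sqrt (B \<omega>)))"
  shows "weak_conv_m (\<lambda>n. distr N borel (A n)) (distr \<Omega> borel B)"
  unfolding weak_conv_m_def weak_conv_def
proof (intro allI impI)
  fix x assume "isCont (cdf (distr \<Omega> borel B)) x"
  then have "isCont (cdf (distr \<Omega> borel (\<lambda>\<omega>. sqrt (B \<omega>)))) (sqrt x)"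
    using assms by (simp add: isCont_cdf_distr)
  then have "(\<lambda>n. cdf (distr N borel (\<lambda>\<omega>. sqrt (A n \<omega>))) (sqrt x))
      \<longlonglongrightarrow> cdf (distr \<Omega> borel (\<lambda>\<omega>. sqrt (B \<omega>))) (sqrt x)"
    using conv by (simp add: weak_conv_m_def weak_conv_def)
  then show "(\<lambda>n. cdf (distr N borel (A n)) x) \<longlonglongrightarrow> cdf (distr \<Omega> borel B) x"
    by (simp add: cdf_distr)
qed

text \<open>
  A continuous mapping theorem for the quotient that avoids weak convergence in the plane: for \<open>V n > 0\<close>,
  \<open>U n / V n \<le> x\<close> is the same event as \<open>U n - x * V n \<le> 0\<close>, which concerns one linear combination.
  Continuity of the limiting distribution function at \<open>x\<close> says that \<open>U' - x * V'\<close> has no atom at \<open>0\<close>.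
\<close>
lemma weak_conv_ratio:
  assumes N: "prob_space N" and O: "prob_space \<Omega>"
    and [measurable]: "\<And>n. U n \<in> borel_measurable N" "\<And>n. V n \<in> borel_measurable N"
      "U' \<in> borel_measurable \<Omega>" "V' \<in> borel_measurable \<Omega>"
    and nonneg: "\<And>n \<omega>. 0 \<le> V n \<omega>"
    and pos: "AE \<omega> in \<Omega>. 0 < V' \<omega>"
    and conv: "\<And>p q. weak_conv_m (\<lambda>n. distr N borel (\<lambda>\<omega>. p * U n \<omega> + q * V n \<omega>))
       (distr \<Omega> borel (\<lambda>\<omega>. p * U' \<omega> + q * V' \<omega>))"
  shows "weak_conv_m (\<lambda>n. distr N borel (\<lambda>\<omega>. U n \<omega> / V n \<omega>)) (distr \<Omega> borel (\<lambda>\<omega>. U' \<omega> / V' \<omega>))"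
  unfolding weak_conv_m_def weak_conv_def
proof (intro allI impI)
  interpret N: prob_space N by fact
  interpret O: prob_space \<Omega> by fact
  have cdf_conv: "(\<lambda>n. measure N {\<omega> \<in> space N. p * U n \<omega> + q * V n \<omega> \<le> 0})
      \<longlonglongrightarrow> measure \<Omega> {\<omega> \<in> space \<Omega>. p * U' \<omega> + q * V' \<omega> \<le> 0}"
    if "measure \<Omega> {\<omega> \<in> space \<Omega>. p * U' \<omega> + q * V' \<omega> = 0} = 0" for p q
  proof -
    have "isCont (cdf (distr \<Omega> borel (\<lambda>\<omega>. p * U' \<omega> + q * V' \<omega>))) 0"
      using that O by (subst isCont_cdf_distr) auto
    then show ?thesis
      using conv[of p q] by (simp add: weak_conv_m_def weak_conv_def cdf_distr)
  qed
  fix x assume "isCont (cdf (distr \<Omega> borel (\<lambda>\<omega>. U' \<omega> / V' \<omega>))) x"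
  then have "measure \<Omega> {\<omega> \<in> space \<Omega>. U' \<omega> / V' \<omega> = x} = 0"
    using O by (subst (asm) isCont_cdf_distr) auto
  also have "measure \<Omega> {\<omega> \<in> space \<Omega>. U' \<omega> / V' \<omega> = x} = measure \<Omega> {\<omega> \<in> space \<Omega>. 1 * U' \<omega> + (- x) * V' \<omega> = 0}"
    using pos by (intro O.finite_measure_eq_AE) (auto simp: field_simps)
  finally have lim1: "(\<lambda>n. measure N {\<omega> \<in> space N. 1 * U n \<omega> + (- x) * V n \<omega> \<le> 0})
      \<longlonglongrightarrow> measure \<Omega> {\<omega> \<in> space \<Omega>. 1 * U' \<omega> + (- x) * V' \<omega> \<le> 0}"
    by (rule cdf_conv)
  have null: "measure \<Omega> {\<omega> \<in> space \<Omega>. 0 * U' \<omega> + 1 * V' \<omega> = 0} = 0"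
    "measure \<Omega> {\<omega> \<in> space \<Omega>. 0 * U' \<omega> + 1 * V' \<omega> \<le> 0} = 0"
    using pos by (subst O.prob_eq_0; auto)+
  from cdf_conv[OF null(1)] have lim2: "(\<lambda>n. measure N {\<omega> \<in> space N. V n \<omega> \<le> 0}) \<longlonglongrightarrow> 0"
    using null(2) by simp
  (* The two events differ only where V n = 0, since the quotient is then 0 whatever U n is. *)
  have bound: "\<bar>measure N {\<omega> \<in> space N. U n \<omega> / V n \<omega> \<le> x}
      - measure N {\<omega> \<in> space N. 1 * U n \<omega> + (- x) * V n \<omega> \<le> 0}\<bar>
      \<le> measure N {\<omega> \<in> space N. V n \<omega> \<le> 0}" (is "\<bar>measure N ?A - measure N ?B\<bar> \<le> measure N ?C") for n
  proof -
    have *: "U n \<omega> / V n \<omega> \<le> x \<longleftrightarrow> 1 * U n \<omega> + (- x) * V n \<omega> \<le> 0" if "\<not> V n \<omega> \<le> 0" for \<omega>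
      using that by (simp add: field_simps)
    have "measure N ?A \<le> measure N (?B \<union> ?C)" "measure N ?B \<le> measure N (?A \<union> ?C)"
      using * by (auto intro!: N.finite_measure_mono)
    moreover have "measure N (?B \<union> ?C) \<le> measure N ?B + measure N ?C"
      "measure N (?A \<union> ?C) \<le> measure N ?A + measure N ?C"
      by (auto intro!: measure_Un_le)
    ultimately show ?thesis by linarith
  qed
  have "(\<lambda>n. measure N {\<omega> \<in> space N. U n \<omega> / V n \<omega> \<le> x}
      - measure N {\<omega> \<in> space N. 1 * U n \<omega> + (- x) * V n \<omega> \<le> 0}) \<longlonglongrightarrow> 0"
    by (rule Lim_null_comparison[OF _ lim2]) (use bound in auto)
  from tendsto_add[OF this lim1]
  have "(\<lambda>n. measure N {\<omega> \<in> space N. U n \<omega> / V n \<omega> \<le> x})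
      \<longlonglongrightarrow> measure \<Omega> {\<omega> \<in> space \<Omega>. 1 * U' \<omega> + (- x) * V' \<omega> \<le> 0}" by simp
  also have "measure \<Omega> {\<omega> \<in> space \<Omega>. 1 * U' \<omega> + (- x) * V' \<omega> \<le> 0} = measure \<Omega> {\<omega> \<in> space \<Omega>. U' \<omega> / V' \<omega> \<le> x}"
    using pos by (intro O.finite_measure_eq_AE) (auto simp: field_simps)
  finally show "(\<lambda>n. cdf (distr N borel (\<lambda>\<omega>. U n \<omega> / V n \<omega>)) x)
      \<longlonglongrightarrow> cdf (distr \<Omega> borel (\<lambda>\<omega>. U' \<omega> / V' \<omega>)) x"
    by (simp add: cdf_distr)
qed

section \<open>The Wiener process on a grid\<close>

text \<open>
  The rescaled values on a grid of mesh \<open>h\<close> form a random walk with standard normal steps. The right-hand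
  side mentions neither the process nor \<open>h\<close>; this is how Brownian scaling and uniqueness in law enter.
\<close>
lemma standard_wiener_grid_law:
  fixes M :: "'a measure"
  assumes W: "standard_wiener M W" and h: "h > 0" and n: "n \<ge> 1"
  shows "distr M (PiM {..n} (\<lambda>_. borel)) (\<lambda>\<omega>. \<lambda>k\<in>{..n}. W (h * real k) \<omega> / sqrt h) =
    distr (PiM {..<n} (\<lambda>_. density lborel std_normal_density)) (PiM {..n} (\<lambda>_. borel))
      (\<lambda>x. \<lambda>k\<in>{..n}. \<Sum>i<k. x i)"
proof -
  interpret prob_space M
    using W by (simp add: standard_wiener_def)
  define t where "t i = h * real i" for i :: nat
  define D where "D i \<omega> = (W (t (Suc i)) \<omega> - W (t i) \<omega>) / sqrt h" for i \<omega>
  let ?G = "density lborel std_normal_density"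
  have t: "0 \<le> t i" "t i < t (Suc i)" "t (Suc i) - t i = h" for i
    using h by (auto simp: t_def algebra_simps)
  have [measurable]: "W (t i) \<in> borel_measurable M" for i
    using W t by (auto simp: standard_wiener_def)
  have [measurable]: "D i \<in> borel_measurable M" for i
    unfolding D_def by measurable
  have "mono t"
    using h by (auto simp: t_def mono_def)
  then have "indep_vars (\<lambda>_. borel) (\<lambda>i \<omega>. W (t (Suc i)) \<omega> - W (t i) \<omega>) {..<n}"
    using W t(1)[of 0] unfolding standard_wiener_def by blast
  then have indep: "indep_vars (\<lambda>_. borel) D {..<n}"
    unfolding D_def by (rule indep_vars_compose2[where Y = "\<lambda>_ x. x / sqrt h"]) auto
  have law_D: "distr M borel (D i) = ?G" for i
  proof -
    have "distributed M lborel (\<lambda>\<omega>. W (t (Suc i)) \<omega> - W (t i) \<omega>) (normal_density 0 (sqrt h))"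
      using W t[of i] unfolding standard_wiener_def by metis
    then have "distributed M lborel (D i) std_normal_density"
      using h by (subst (asm) normal_standard_normal_convert) (auto simp: D_def[abs_def])
    moreover have "distr M borel (D i) = distr M lborel (D i)"
      by (rule distr_cong) auto
    ultimately show ?thesis
      by (simp add: distributed_distr_eq_density)
  qed
  have "distr M (PiM {..<n} (\<lambda>_. borel)) (\<lambda>\<omega>. \<lambda>i\<in>{..<n}. D i \<omega>) = PiM {..<n} (\<lambda>i. distr M borel (D i))"
    using n indep by (subst indep_vars_iff_distr_eq_PiM[symmetric]) (auto simp: lessThan_empty_iff)
  then have law: "distr M (PiM {..<n} (\<lambda>_. borel)) (\<lambda>\<omega>. \<lambda>i\<in>{..<n}. D i \<omega>) = PiM {..<n} (\<lambda>_. ?G)"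
    by (simp add: law_D)
  let ?S = "\<lambda>x. \<lambda>k\<in>{..n}. \<Sum>i<k. x i :: real"
  have meas_S: "?S \<in> measurable (PiM {..<n} (\<lambda>_. borel)) (PiM {..n} (\<lambda>_. borel))"
    by (auto intro!: measurable_restrict borel_measurable_sum measurable_component_singleton)
  have "distr (PiM {..<n} (\<lambda>_. ?G)) (PiM {..n} (\<lambda>_. borel)) ?S =
      distr M (PiM {..n} (\<lambda>_. borel)) (?S \<circ> (\<lambda>\<omega>. \<lambda>i\<in>{..<n}. D i \<omega>))"
    unfolding law[symmetric] by (intro distr_distr meas_S) measurable
  also have "\<dots> = distr M (PiM {..n} (\<lambda>_. borel)) (\<lambda>\<omega>. \<lambda>k\<in>{..n}. W (t k) \<omega> / sqrt h)"
  proof (rule distr_cong_AE)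
    have "AE \<omega> in M. W 0 \<omega> = 0"
      using W by (simp add: standard_wiener_def)
    then show "AE \<omega> in M. (?S \<circ> (\<lambda>\<omega>. \<lambda>i\<in>{..<n}. D i \<omega>)) \<omega> = (\<lambda>k\<in>{..n}. W (t k) \<omega> / sqrt h)"
    proof eventually_elim
      case (elim \<omega>)
      have "(\<Sum>i<k. (\<lambda>i\<in>{..<n}. D i \<omega>) i) = W (t k) \<omega> / sqrt h" if "k \<le> n" for k
      proof -
        have "(\<Sum>i<k. (\<lambda>i\<in>{..<n}. D i \<omega>) i) = (\<Sum>i<k. W (t (Suc i)) \<omega> / sqrt h - W (t i) \<omega> / sqrt h)"
          using that by (intro sum.cong) (auto simp: D_def diff_divide_distrib)
        also have "\<dots> = W (t k) \<omega> / sqrt h"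
          using elim by (subst sum_lessThan_telescope) (simp add: t_def)
        finally show ?thesis .
      qed
      then show ?case by (auto simp: fun_eq_iff)
    qed
    show "?S \<circ> (\<lambda>\<omega>. \<lambda>i\<in>{..<n}. D i \<omega>) \<in> measurable M (PiM {..n} (\<lambda>_. borel))"
      by (intro measurable_comp[OF _ meas_S]) measurable
  qed auto
  finally show ?thesis by (simp add: t_def)
qed

lemma standard_wiener_scaling_law:
  assumes W: "standard_wiener M W" "standard_wiener N V" and h: "g > 0" "h > 0" and n: "n \<ge> 1"
    and F: "F \<in> borel_measurable (PiM {..n} (\<lambda>_. borel))"
    and local: "\<And>s. F (restrict s {..n}) = F s"
  shows "distr M borel (\<lambda>\<omega>. F (\<lambda>k. W (g * real k) \<omega> / sqrt g)) =
    distr N borel (\<lambda>\<omega>. F (\<lambda>k. V (h * real k) \<omega> / sqrt h))"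
proof -
  have *: "distr L borel (\<lambda>\<omega>. F (\<lambda>k. U (c * real k) \<omega> / sqrt c)) =
     distr (distr L (PiM {..n} (\<lambda>_. borel)) (\<lambda>\<omega>. \<lambda>k\<in>{..n}. U (c * real k) \<omega> / sqrt c)) borel F"
    if "standard_wiener L U" "c > 0" for c and L :: "'d measure" and U
  proof -
    have [measurable]: "U (c * real k) \<in> borel_measurable L" for k
      using that by (auto simp: standard_wiener_def)
    show ?thesis
      by (subst distr_distr[OF F]) (auto simp: comp_def local)
  qed
  show ?thesis
    unfolding *[OF W(1) h(1)] *[OF W(2) h(2)]
    by (simp add: standard_wiener_grid_law[OF _ _ n] W h)
qed

text \<open>
  The limit of the variance estimator is positive because of this: since \<open>W 0 = 0\<close> almost surely, the
  bridge increment over \<open>[0, \<beta>]\<close> is almost surely equal to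
  \<open>(1 - \<beta>) * (W \<beta> - W 0) - \<beta> * (W 1 - W \<beta>)\<close>, a nondegenerate combination of independent normal
  variables, hence has a density.
\<close>
lemma standard_wiener_bridge_nonzero:
  assumes W: "standard_wiener M W" and \<beta>: "0 < \<beta>" "\<beta> < 1"
  shows "AE \<omega> in M. W \<beta> \<omega> - W 0 \<omega> - \<beta> * W 1 \<omega> \<noteq> 0"
proof -
  interpret prob_space M
    using W by (simp add: standard_wiener_def)
  define t :: "nat \<Rightarrow> real" where "t i = (if i = 0 then 0 else if i = 1 then \<beta> else 1)" for i
  define c :: "nat \<Rightarrow> real" where "c i = (if i = 0 then 1 - \<beta> else - \<beta>)" for i
  define D where "D i \<omega> = W (t (Suc i)) \<omega> - W (t i) \<omega>" for i \<omega>
  have "mono t"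
    using \<beta> by (auto simp: t_def mono_def)
  moreover have "0 \<le> t 0"
    by (simp add: t_def)
  ultimately have "indep_vars (\<lambda>_. borel) D {..<2}"
    using W unfolding standard_wiener_def D_def[abs_def] by blast
  then have indep: "indep_vars (\<lambda>_. borel) (\<lambda>i \<omega>. c i * D i \<omega>) {..<2}"
    by (rule indep_vars_compose2[where Y = "\<lambda>i x. c i * x"]) auto
  have "distributed M lborel (\<lambda>\<omega>. c i * D i \<omega>) (normal_density 0 (\<bar>c i\<bar> * sqrt (t (Suc i) - t i)))"
    if i: "i \<in> {..<2}" for i
  proof -
    have *: "0 \<le> t i" "t i < t (Suc i)" "c i \<noteq> 0"
      using i \<beta> by (auto simp: t_def c_def)
    then have "distributed M lborel (D i) (normal_density 0 (sqrt (t (Suc i) - t i)))"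
      using W unfolding standard_wiener_def D_def[abs_def] by blast
    from normal_density_affine[OF this, of "c i" 0] * show ?thesis by simp
  qed
  with indep have "distributed M lborel (\<lambda>\<omega>. \<Sum>i<2. c i * D i \<omega>)
      (normal_density (\<Sum>i<(2::nat). 0) (sqrt (\<Sum>i<2. (\<bar>c i\<bar> * sqrt (t (Suc i) - t i))\<^sup>2)))"
    using \<beta> by (intro sum_indep_normal) (auto simp: t_def c_def lessThan_empty_iff)
  then obtain v where "distributed M lborel (\<lambda>\<omega>. \<Sum>i<2. c i * D i \<omega>) (normal_density 0 v)"
    by simp
  moreover have "(\<Sum>i<2. c i * D i \<omega>) = W \<beta> \<omega> - \<beta> * W 1 \<omega> - (1 - \<beta>) * W 0 \<omega>" for \<omega>
    by (simp add: numeral_2_eq_2 c_def D_def t_def algebra_simps)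
  ultimately have dist: "distributed M lborel (\<lambda>\<omega>. W \<beta> \<omega> - \<beta> * W 1 \<omega> - (1 - \<beta>) * W 0 \<omega>) (normal_density 0 v)"
    by simp
  have "AE x in lborel. 0 < ennreal (normal_density 0 v x) \<longrightarrow> x \<noteq> 0"
    using AE_lborel_singleton[of "0::real"] by eventually_elim auto
  then have "AE x in density lborel (normal_density 0 v). x \<noteq> 0"
    by (rule AE_density[THEN iffD2, rotated]) measurable
  then have "AE x in distr M lborel (\<lambda>\<omega>. W \<beta> \<omega> - \<beta> * W 1 \<omega> - (1 - \<beta>) * W 0 \<omega>). x \<noteq> 0"
    by (simp only: distributed_distr_eq_density[OF dist])
  then have "AE \<omega> in M. W \<beta> \<omega> - \<beta> * W 1 \<omega> - (1 - \<beta>) * W 0 \<omega> \<noteq> 0"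
    using distributed_measurable[OF dist] by (subst (asm) AE_distr_iff) auto
  moreover have "AE \<omega> in M. W 0 \<omega> = 0"
    using W by (simp add: standard_wiener_def)
  ultimately show ?thesis
    by eventually_elim auto
qed

section \<open>Mean squares of batch increments along a continuous path\<close>

text \<open>
  The samples \<open>a i\<close> only have to be uniformly close to the integrand on the cells, because the batch statistic
  samples a function that itself varies with \<open>n\<close>, at points that are not exactly grid points.
\<close>
lemma riemann_sum_error:
  fixes f :: "real \<Rightarrow> real"
  assumes f: "continuous_on {0..L} f" and L: "L > 0" and b: "b \<ge> 1"
    and close: "\<And>i u. i < b \<Longrightarrow> real i * (L / b) \<le> u \<Longrightarrow> u \<le> real (Suc i) * (L / b) \<Longrightarrow> \<bar>f u - a i\<bar> \<le> e"
  shows "\<bar>(\<Sum>i<b. a i) / b - integral {0..L} f / L\<bar> \<le> e"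
proof -
  define h where "h = L / b"
  have h: "h > 0" "real b * h = L"
    using L b by (auto simp: h_def)
  have "\<bar>integral {0..real k * h} f - h * (\<Sum>i<k. a i)\<bar> \<le> real k * h * e" if "k \<le> b" for k
    using that
  proof (induction k)
    case (Suc k)
    define u v where "u = real k * h" and "v = real (Suc k) * h"
    have uv: "0 \<le> u" "u \<le> v" "v - u = h"
      using h by (auto simp: u_def v_def algebra_simps)
    have "v \<le> L"
      using Suc.prems h unfolding v_def h(2)[symmetric] by (intro mult_right_mono) auto
    then have cont: "continuous_on {0..v} f" "continuous_on {u..v} f"
      using uv by (auto intro: continuous_on_subset[OF f])
    have "integral {0..v} f = integral {0..u} f + integral {u..v} f"
      using uv cont by (intro Henstock_Kurzweil_Integration.integral_combine[symmetric] integrable_continuous_real)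
    moreover have "\<bar>integral {u..v} f - h * a k\<bar> \<le> e * h"
    proof -
      have "norm (integral {u..v} (\<lambda>x. f x - a k)) \<le> e * (v - u)"
        using uv cont close[of k] Suc.prems
        by (intro integral_bound) (auto intro!: continuous_intros simp: u_def v_def h_def)
      also have "integral {u..v} (\<lambda>x. f x - a k) = integral {u..v} f - h * a k"
        using uv cont
        by (subst Henstock_Kurzweil_Integration.integral_diff) (auto intro: integrable_continuous_real)
      finally show ?thesis by (simp add: uv)
    qed
    moreover have "\<bar>integral {0..u} f - h * (\<Sum>i<k. a i)\<bar> \<le> real k * h * e"
      using Suc unfolding u_def by simp
    ultimately have "\<bar>integral {0..v} f - h * (\<Sum>i<Suc k. a i)\<bar> \<le> real k * h * e + e * h"
      by (simp add: algebra_simps)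
    then show ?case
      by (simp add: v_def algebra_simps)
  qed simp
  from this[of b] have "\<bar>integral {0..L} f - h * (\<Sum>i<b. a i)\<bar> \<le> L * e"
    by (simp add: h(2))
  then have "\<bar>integral {0..L} f - h * (\<Sum>i<b. a i)\<bar> / L \<le> e"
    using L by (simp add: field_simps)
  also have "\<bar>integral {0..L} f - h * (\<Sum>i<b. a i)\<bar> / L = \<bar>(integral {0..L} f - h * (\<Sum>i<b. a i)) / L\<bar>"
    using L by simp
  also have "(integral {0..L} f - h * (\<Sum>i<b. a i)) / L = - ((\<Sum>i<b. a i) / b - integral {0..L} f / L)"
    using L b by (simp add: h_def field_simps)
  finally show ?thesis by (simp only: abs_minus_cancel)
qed

text \<open>
  The relation \<open>d = (n - m) / (b - 1)\<close> over the naturals: the last of the \<open>b\<close> batches ends exactly at \<open>n\<close>.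
\<close>
definition batches_tile :: "nat \<Rightarrow> nat \<Rightarrow> nat \<Rightarrow> nat \<Rightarrow> bool" where
  "batches_tile n m d b \<longleftrightarrow> m \<ge> 1 \<and> d \<ge> 1 \<and> b \<ge> 2 \<and> (b - 1) * d + m = n"

text \<open>
  A single batch is excluded because the quotient by \<open>b - 1 = 0\<close> would make the offset \<open>d\<close> vanish.
\<close>
lemma batches_tile_if_offset:
  assumes "m \<ge> 1" "d \<ge> 1" "b \<ge> 1" "real d = (real n - real m) / (real b - 1)"
  shows "batches_tile n m d b"
proof -
  have "b \<noteq> 1"
    using assms by auto
  then have b: "b \<ge> 2"
    using assms by auto
  then have "real ((b - 1) * d + m) = real n"
    using assms by (simp add: of_nat_diff field_simps)
  then have "(b - 1) * d + m = n"
    by (simp only: of_nat_eq_iff)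
  then show ?thesis
    using assms b by (simp add: batches_tile_def)
qed

lemma batches_tile_offset:
  "batches_tile n m d b \<Longrightarrow> real d = (real n - real m) / (real b - 1)"
  by (auto simp: batches_tile_def of_nat_diff)

lemma batches_tile_end:
  assumes "batches_tile n m d b" "i < b"
  shows "i * d + m \<le> n"
proof -
  have "i * d \<le> (b - 1) * d"
    using assms by (intro mult_right_mono) auto
  then show ?thesis
    using assms by (auto simp: batches_tile_def)
qed

text \<open>
  For a bounded number of batches the batch end points converge one by one to those of the limit.
\<close>
lemma mean_square_increments_tendsto_sum:
  fixes w :: "real \<Rightarrow> real"
  assumes w: "continuous_on {0..} w"
    and tile: "\<forall>\<^sub>F n in sequentially. batches_tile n (m n) (d n) (b n)"
    and beta: "(\<lambda>n. real (m n) / real n) \<longlonglongrightarrow> \<beta>" "0 < \<beta>" "\<beta> < 1"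
    and b: "\<forall>\<^sub>F n in sequentially. b n = k"
  shows "(\<lambda>n. (\<Sum>i<b n. (w (real (i * d n + m n) / n) - w (real (i * d n) / n) - m n / n * w 1)\<^sup>2) / b n)
    \<longlonglongrightarrow> (\<Sum>i<k. (w (real i * ((1 - \<beta>) / (real k - 1)) + \<beta>) - w (real i * ((1 - \<beta>) / (real k - 1))) - \<beta> * w 1)\<^sup>2) / k"
proof -
  have "eventually (\<lambda>n. n > 0 \<and> b n = k \<and> batches_tile n (m n) (d n) (b n)) sequentially"
    using tile b eventually_gt_at_top[of 0] by eventually_elim auto
  note ev = this
  then have k: "k \<ge> 2"
    by (auto simp: batches_tile_def dest!: eventually_happens)
  have offset: "(\<lambda>n. real (d n) / n) \<longlonglongrightarrow> (1 - \<beta>) / (real k - 1)"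
  proof (rule Lim_transform_eventually)
    show "(\<lambda>n. (1 - m n / n) / (real k - 1)) \<longlonglongrightarrow> (1 - \<beta>) / (real k - 1)"
      using k by (intro tendsto_intros beta) auto
    show "\<forall>\<^sub>F n in sequentially. (1 - m n / n) / (real k - 1) = d n / n"
      using ev by eventually_elim (auto simp: batches_tile_offset diff_divide_distrib)
  qed
  have start: "(\<lambda>n. w (real (i * d n) / n)) \<longlonglongrightarrow> w (real i * ((1 - \<beta>) / (real k - 1)))" for i
    using k beta tendsto_mult[OF tendsto_const offset, of "real i"]
    by (intro continuous_on_tendsto_compose[OF w]) auto
  have stop: "(\<lambda>n. w (real (i * d n + m n) / n)) \<longlonglongrightarrow> w (real i * ((1 - \<beta>) / (real k - 1)) + \<beta>)" for i
    using k beta tendsto_add[OF tendsto_mult[OF tendsto_const offset, of "real i"] beta(1)]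
    by (intro continuous_on_tendsto_compose[OF w]) (auto simp: add_divide_distrib)
  show ?thesis
  proof (rule Lim_transform_eventually)
    show "(\<lambda>n. (\<Sum>i<k. (w (real (i * d n + m n) / n) - w (real (i * d n) / n) - m n / n * w 1)\<^sup>2) / k)
      \<longlonglongrightarrow> (\<Sum>i<k. (w (real i * ((1 - \<beta>) / (real k - 1)) + \<beta>) - w (real i * ((1 - \<beta>) / (real k - 1))) - \<beta> * w 1)\<^sup>2) / k"
      using k by (intro tendsto_intros start stop beta) auto
  qed (use b in eventually_elim, simp)
qed

text \<open>
  For a growing number of batches the offsets become dense in \<open>[0, 1 - \<beta>]\<close> and the mean square becomes a
  Riemann sum. Both the sample points and the integrand depend on \<open>n\<close>; uniform continuity in the two end
  points and the relative batch size controls them together.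
\<close>
lemma mean_square_increments_tendsto_integral:
  fixes w :: "real \<Rightarrow> real"
  assumes w: "continuous_on {0..} w"
    and tile: "\<forall>\<^sub>F n in sequentially. batches_tile n (m n) (d n) (b n)"
    and beta: "(\<lambda>n. real (m n) / real n) \<longlonglongrightarrow> \<beta>" "0 < \<beta>" "\<beta> < 1"
    and b: "filterlim b at_top sequentially"
  shows "(\<lambda>n. (\<Sum>i<b n. (w (real (i * d n + m n) / n) - w (real (i * d n) / n) - m n / n * w 1)\<^sup>2) / b n)
    \<longlonglongrightarrow> integral {0..1 - \<beta>} (\<lambda>u. (w (u + \<beta>) - w u - \<beta> * w 1)\<^sup>2) / (1 - \<beta>)"
proof -
  define L where "L = 1 - \<beta>"
  have L: "0 < L" "L < 1" using beta by (auto simp: L_def)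
  define f where "f u = (w (u + \<beta>) - w u - \<beta> * w 1)\<^sup>2" for u
  define G where "G = (\<lambda>(u, v, h). (w v - w u - h * w 1)\<^sup>2)"
  (* All times and relative sizes that occur are at most 1, so any compact box containing the unit cube serves. *)
  define D where "D = {0..2::real} \<times> {0..2::real} \<times> {0..2::real}"
  have "continuous_on D G"
    unfolding G_def split_beta D_def
    by (intro continuous_intros continuous_on_compose2[OF w]) auto
  moreover have "compact D"
    unfolding D_def by (intro compact_Times compact_Icc)
  ultimately have uc: "uniformly_continuous_on D G"
    by (rule compact_uniformly_continuous)
  have f: "continuous_on {0..L} f"
    unfolding f_def using beta by (intro continuous_intros continuous_on_compose2[OF w]) auto
  (* The i-th offset is compared with the whole i-th cell of the regular grid of mesh L / b n: the
     first term of \<eta> is the length of a cell, the second the drift accumulated over all cells. *)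
  define \<eta> where "\<eta> n = L / b n + \<bar>L - b n * (d n / n)\<bar>" for n
  have lim_L: "(\<lambda>n. real (b n) * (d n / n)) \<longlonglongrightarrow> 1 * (1 - \<beta>)"
  proof (rule Lim_transform_eventually)
    have "((\<lambda>k. real k / (real k - 1)) \<longlongrightarrow> 1) at_top"
      by real_asymp
    from filterlim_compose[OF this b]
    show "(\<lambda>n. real (b n) / (real (b n) - 1) * (1 - m n / n)) \<longlonglongrightarrow> 1 * (1 - \<beta>)"
      by (intro tendsto_intros beta)
    show "\<forall>\<^sub>F n in sequentially. real (b n) / (real (b n) - 1) * (1 - m n / n) = b n * (d n / n)"
      using tile eventually_gt_at_top[of 0]
    proof eventually_elim
      case (elim n)
      then show ?case
        by (subst batches_tile_offset[OF elim(1)]) (auto simp: field_simps)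
    qed
  qed
  have lim_0: "(\<lambda>n. L / b n) \<longlonglongrightarrow> 0"
    by (rule real_tendsto_divide_at_top[OF tendsto_const])
      (rule filterlim_compose[OF filterlim_real_sequentially b])
  have "\<eta> \<longlonglongrightarrow> 0 + \<bar>L - 1 * (1 - \<beta>)\<bar>"
    unfolding \<eta>_def by (rule tendsto_add[OF lim_0 tendsto_rabs[OF tendsto_diff[OF tendsto_const lim_L]]])
  then have "(\<lambda>n. 2 * \<eta> n + 2 * \<bar>m n / n - \<beta>\<bar>) \<longlonglongrightarrow> 2 * (0 + \<bar>L - 1 * (1 - \<beta>)\<bar>) + 2 * \<bar>\<beta> - \<beta>\<bar>"
    by (intro tendsto_intros beta)
  then have small: "(\<lambda>n. 2 * \<eta> n + 2 * \<bar>m n / n - \<beta>\<bar>) \<longlonglongrightarrow> 0"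
    by (simp add: L_def)
  show ?thesis
    unfolding f_def[symmetric] L_def[symmetric]
  proof (rule metric_LIMSEQ_I, unfold eventually_sequentially[symmetric])
    fix e :: real assume e: "e > 0"
    then obtain r where r: "r > 0" "\<And>p q. p \<in> D \<Longrightarrow> q \<in> D \<Longrightarrow> dist p q < r \<Longrightarrow> dist (G p) (G q) < e / 2"
      using uc unfolding uniformly_continuous_on_def by (metis half_gt_zero)
    have "\<forall>\<^sub>F n in sequentially. 2 * \<eta> n + 2 * \<bar>m n / n - \<beta>\<bar> < r"
      using order_tendstoD(2)[OF small r(1)] .
    then show "\<forall>\<^sub>F n in sequentially. dist
       ((\<Sum>i<b n. (w (real (i * d n + m n) / n) - w (real (i * d n) / n) - m n / n * w 1)\<^sup>2) / b n)
       (integral {0..L} f / L) < e"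
      using tile eventually_gt_at_top[of 0]
    proof eventually_elim
      case (elim n)
      have near: "\<bar>f u - (w (real (i * d n + m n) / n) - w (real (i * d n) / n) - m n / n * w 1)\<^sup>2\<bar> \<le> e / 2"
        if i: "i < b n" and u: "real i * (L / b n) \<le> u" "u \<le> real (Suc i) * (L / b n)" for i u
      proof -
        let ?p = "(u, u + \<beta>, \<beta>)"
        let ?q = "(real (i * d n) / n, real (i * d n + m n) / n, m n / n)"
        have "real (Suc i) * (L / b n) \<le> real (b n) * (L / b n)"
          using i L by (intro mult_right_mono) auto
        then have "u \<le> L" "0 \<le> u"
          using u i L by (auto intro: order_trans[rotated])
        then have p: "?p \<in> D"
          using beta L by (auto simp: D_def L_def)
        have "i * d n + m n \<le> n"
          by (rule batches_tile_end[OF elim(2) i])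
        then have "real (i * d n) \<le> real n" "real (i * d n + m n) \<le> real n" "real (m n) \<le> real n"
          by linarith+
        then have q: "?q \<in> D"
          using elim(3) by (auto simp: D_def divide_simps simp del: of_nat_mult of_nat_add)
        have "\<bar>real i * (L / b n - d n / n)\<bar> \<le> \<bar>real (b n) * (L / b n - d n / n)\<bar>"
          unfolding abs_mult using i by (intro mult_right_mono) auto
        also have "real (b n) * (L / b n - d n / n) = L - b n * (d n / n)"
          using i by (simp add: algebra_simps)
        finally have "\<bar>real i * (L / b n) - real i * (d n / n)\<bar> \<le> \<bar>L - b n * (d n / n)\<bar>"
          by (simp only: right_diff_distrib)
        moreover have "real (i * d n) / n = real i * (d n / n)"
          "real (Suc i) * (L / b n) = real i * (L / b n) + L / b n"
          by (simp_all add: algebra_simps add_divide_distrib)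
        moreover have "\<bar>v - y\<bar> \<le> s + t" if "\<bar>x - y\<bar> \<le> t" "x \<le> v" "v \<le> x + s" for v x y s t :: real
          using that by linarith
        ultimately have start: "\<bar>u - real (i * d n) / n\<bar> \<le> \<eta> n"
          using u unfolding \<eta>_def by metis
        have "dist ?p ?q \<le> \<bar>u - real (i * d n) / n\<bar> + (\<bar>u + \<beta> - real (i * d n + m n) / n\<bar> + \<bar>\<beta> - m n / n\<bar>)"
          unfolding dist_Pair_Pair dist_real_def
          by (intro order_trans[OF sqrt_sum_squares_le_sum] add_mono) auto
        also have "\<dots> \<le> \<eta> n + ((\<eta> n + \<bar>m n / n - \<beta>\<bar>) + \<bar>m n / n - \<beta>\<bar>)"
        proof -
          have "real (i * d n + m n) / n = real (i * d n) / n + m n / n"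
            by (simp add: add_divide_distrib)
          then show ?thesis
            using start by linarith
        qed
        also have "\<dots> < r"
          using elim(1) by simp
        finally have "dist (G ?p) (G ?q) < e / 2"
          by (rule r(2)[OF p q])
        then show ?thesis
          by (simp add: G_def f_def dist_real_def)
      qed
      have "\<bar>(\<Sum>i<b n. (w (real (i * d n + m n) / n) - w (real (i * d n) / n) - m n / n * w 1)\<^sup>2) / b n
          - integral {0..L} f / L\<bar> \<le> e / 2"
        by (rule riemann_sum_error[OF f L(1)]) (use near elim(2) in \<open>auto simp: batches_tile_def\<close>)
      then show ?case
        using e by (simp add: dist_real_def)
    qed
  qed
qed

text \<open>
  The statistic \<open>sigma2_OB_I\<close> for sample means of the steps of a walk \<open>s\<close>, with batches counted
  from \<open>0\<close>. A general estimation rule is compared with this one.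
\<close>
definition walk_sigma2 :: "real \<Rightarrow> nat \<Rightarrow> nat \<Rightarrow> nat \<Rightarrow> nat \<Rightarrow> (nat \<Rightarrow> real) \<Rightarrow> real" where
  "walk_sigma2 \<beta> n m d b s =
     1 / (1 - \<beta>) * (real m / real b) *
       (\<Sum>i<b. ((s (i * d + m) - s (i * d)) / real m - s n / real n)\<^sup>2)"

text \<open>
  The factor \<open>sqrt n\<close> of the rescaled walk turns the weight \<open>m\<close> of the estimator into \<open>n / m\<close>, which
  tends to \<open>1 / \<beta>\<close>.
\<close>
lemma walk_sigma2_scaled:
  assumes "n > 0" "m > 0"
  shows "walk_sigma2 \<beta> n m d b (\<lambda>k. w (1 / real n * real k) / sqrt (1 / real n)) =
     1 / (1 - \<beta>) * (1 / (m / n)) *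
       ((\<Sum>i<b. (w (real (i * d + m) / n) - w (real (i * d) / n) - m / n * w 1)\<^sup>2) / b)"
proof -
  have *: "((w (1 / real n * real (i * d + m)) / sqrt (1 / real n) -
      w (1 / real n * real (i * d)) / sqrt (1 / real n)) / m - w (1 / real n * n) / sqrt (1 / real n) / n)\<^sup>2
    = (w (real (i * d + m) / n) - w (real (i * d) / n) - m / n * w 1)\<^sup>2 * (n / m\<^sup>2)" (is "?x\<^sup>2 = ?y\<^sup>2 * _") for i
  proof -
    have "?x = ?y * (sqrt n / m)"
      using assms by (simp add: real_sqrt_divide field_simps)
    then show ?thesis
      by (simp only: power_mult_distrib power_divide) simp
  qed
  have "A * (m / b) * (S * (n / m\<^sup>2)) = A * (1 / (m / n)) * (S / b)" for A S :: real
    using assms by (simp add: power2_eq_square mult_ac)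
  then show ?thesis
    unfolding walk_sigma2_def * sum_distrib_right[symmetric] by blast
qed

lemma chi2_OB_I_finite:
  "chi2_OB_I W \<beta> (enat k) \<omega> = 1 / (1 - \<beta>) * (1 / \<beta>) *
     ((\<Sum>i<k. (W (real i * ((1 - \<beta>) / (real k - 1)) + \<beta>) \<omega> - W (real i * ((1 - \<beta>) / (real k - 1))) \<omega> - \<beta> * W 1 \<omega>)\<^sup>2) / k)"
  by (simp add: chi2_OB_I_def kappa1_def Let_def sum.atLeast1_atMost_eq)

lemma chi2_OB_I_infinite:
  assumes "continuous_on {0..} (\<lambda>t. W t \<omega>)" "0 < \<beta>"
  shows "chi2_OB_I W \<beta> \<infinity> \<omega> = 1 / (1 - \<beta>) * (1 / \<beta>) *
     (integral {0..1 - \<beta>} (\<lambda>u. (W (u + \<beta>) \<omega> - W u \<omega> - \<beta> * W 1 \<omega>)\<^sup>2) / (1 - \<beta>))"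
proof -
  have "continuous_on {0..1 - \<beta>} (\<lambda>u. (W (u + \<beta>) \<omega> - W u \<omega> - \<beta> * W 1 \<omega>)\<^sup>2)"
    using assms(2) by (intro continuous_intros continuous_on_compose2[OF assms(1)]) auto
  from set_borel_integral_eq_integral(2)[OF borel_integrable_atLeastAtMost'[OF this]]
  show ?thesis
    by (simp add: chi2_OB_I_def kappa1_def)
qed

text \<open>
  The pathwise half of the theorem: the two shapes of the limit come from a bounded and an unbounded number of
  batches, and the factor \<open>1 / \<beta>\<close> from the rescaling above.
\<close>
lemma walk_sigma2_tendsto_chi2:
  assumes w: "continuous_on {0..} (\<lambda>t. W t \<omega>)"
    and tile: "\<forall>\<^sub>F n in sequentially. batches_tile n (m n) (d n) (b n)"
    and beta: "(\<lambda>n. real (m n) / real n) \<longlonglongrightarrow> \<beta>" "0 < \<beta>" "\<beta> < 1"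
    and b: "(\<lambda>n. enat (b n)) \<longlonglongrightarrow> b_inf"
  shows "(\<lambda>n. walk_sigma2 \<beta> n (m n) (d n) (b n) (\<lambda>k. W (1 / real n * real k) \<omega> / sqrt (1 / real n)))
    \<longlonglongrightarrow> chi2_OB_I W \<beta> b_inf \<omega>"
proof -
  let ?S = "\<lambda>n. (\<Sum>i<b n. (W (real (i * d n + m n) / n) \<omega> - W (real (i * d n) / n) \<omega> - m n / n * W 1 \<omega>)\<^sup>2) / b n"
  have "(\<lambda>n. 1 / (1 - \<beta>) * (1 / (m n / n)) * ?S n) \<longlonglongrightarrow> chi2_OB_I W \<beta> b_inf \<omega>"
  proof (cases b_inf)
    case (enat k)
    have "\<forall>\<^sub>F n in sequentially. b n = k"
    proof (cases k)
      case 0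
      then show ?thesis
        using order_tendstoD(2)[OF b, of "enat 1"] enat by (auto elim!: eventually_mono simp: one_enat_def)
    next
      case (Suc j)
      have "\<forall>\<^sub>F n in sequentially. enat (b n) < enat (Suc k)" "\<forall>\<^sub>F n in sequentially. enat j < enat (b n)"
        by (rule order_tendstoD[OF b], simp add: enat Suc)+
      then show ?thesis
        by eventually_elim (simp add: Suc)
    qed
    then show ?thesis
      unfolding enat chi2_OB_I_finite using beta
      by (intro tendsto_intros mean_square_increments_tendsto_sum[OF w tile beta]) auto
  next
    case infinity
    have "filterlim b at_top sequentially"
      unfolding filterlim_at_top
    proof
      fix z
      have "\<forall>\<^sub>F n in sequentially. enat z < enat (b n)"
        by (rule order_tendstoD(1)[OF b]) (simp add: infinity)
      then show "\<forall>\<^sub>F n in sequentially. z \<le> b n"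
        by eventually_elim simp
    qed
    then show ?thesis
      unfolding infinity chi2_OB_I_infinite[of W \<omega> \<beta>, OF w beta(2)] using beta
      by (intro tendsto_intros mean_square_increments_tendsto_integral[OF w tile beta]) auto
  qed
  moreover have "\<forall>\<^sub>F n in sequentially. 1 / (1 - \<beta>) * (1 / (m n / n)) * ?S n =
      walk_sigma2 \<beta> n (m n) (d n) (b n) (\<lambda>k. W (1 / real n * real k) \<omega> / sqrt (1 / real n))"
    using tile eventually_gt_at_top[of 0]
    by eventually_elim (subst walk_sigma2_scaled, auto simp: batches_tile_def)
  ultimately show ?thesis
    by (rule Lim_transform_eventually)
qed

text \<open>
  The summand with index \<open>0\<close>, respectively the continuous integrand at \<open>0\<close>, is the square of the
  bridge increment over \<open>[0, \<beta>]\<close>.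
\<close>
lemma chi2_OB_I_pos:
  assumes w: "continuous_on {0..} (\<lambda>t. W t \<omega>)" and beta: "0 < \<beta>" "\<beta> < 1" and b: "b_inf \<ge> 2"
    and nz: "W \<beta> \<omega> - W 0 \<omega> - \<beta> * W 1 \<omega> \<noteq> 0"
  shows "chi2_OB_I W \<beta> b_inf \<omega> > 0"
proof (cases b_inf)
  case (enat k)
  then have k: "k \<ge> 2"
    using b by (simp add: numeral_eq_enat)
  have "0 < (\<Sum>i<k. (W (real i * ((1 - \<beta>) / (real k - 1)) + \<beta>) \<omega> - W (real i * ((1 - \<beta>) / (real k - 1))) \<omega> - \<beta> * W 1 \<omega>)\<^sup>2)"
    using k nz by (intro sum_pos2[where i = 0]) auto
  then show ?thesis
    using k beta unfolding enat chi2_OB_I_finite by simp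
next
  case infinity
  let ?f = "\<lambda>u. (W (u + \<beta>) \<omega> - W u \<omega> - \<beta> * W 1 \<omega>)\<^sup>2"
  have cont: "continuous_on {0..1 - \<beta>} ?f"
    using beta by (intro continuous_intros continuous_on_compose2[OF w]) auto
  have "integral {0..1 - \<beta>} ?f \<ge> 0"
    by (intro integral_nonneg integrable_continuous_real cont) auto
  moreover have "integral {0..1 - \<beta>} ?f \<noteq> 0"
    using integral_eq_0_iff[OF cont] nz beta by force
  ultimately show ?thesis
    using beta unfolding infinity chi2_OB_I_infinite[of W \<omega> \<beta>, OF w beta(1)] by simp
qed

lemma walk_sigma2_measurable:
  assumes [measurable]: "\<And>k. s k \<in> borel_measurable M"
  shows "(\<lambda>\<omega>. walk_sigma2 \<beta> n m d b (\<lambda>k. s k \<omega>)) \<in> borel_measurable M"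
  unfolding walk_sigma2_def by measurable

lemma walk_sigma2_local:
  assumes "batches_tile n m d b"
  shows "walk_sigma2 \<beta> n m d b (restrict s {..n}) = walk_sigma2 \<beta> n m d b s"
proof -
  have "i * d + m \<le> n" "i * d \<le> n" if "i < b" for i
    using batches_tile_end[OF assms that] by auto
  then show ?thesis
    unfolding walk_sigma2_def by (intro arg_cong2[where f = "(*)"] refl sum.cong) auto
qed

section \<open>Approximation of the batch estimators by a random walk\<close>

text \<open>
  Minkowski's inequality. Comparing roots, not squares, gives a bound free of the size of \<open>x\<close> and \<open>y\<close>;
  this matters because the walk statistic converges in law only and is not bounded along a sample path.
\<close>
lemma root_mean_square_lipschitz:
  fixes x y :: "nat \<Rightarrow> real"
  assumes c: "c \<ge> 0" and b: "b \<ge> 1" and close: "\<And>i. i < b \<Longrightarrow> \<bar>x i - y i\<bar> \<le> e"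
  shows "\<bar>sqrt (c / b * (\<Sum>i<b. (x i)\<^sup>2)) - sqrt (c / b * (\<Sum>i<b. (y i)\<^sup>2))\<bar> \<le> sqrt c * e"
proof -
  have e: "e \<ge> 0"
    using close[of 0] b by (auto intro: order_trans[OF abs_ge_zero])
  have tri: "L2_set f {..<b} - L2_set g {..<b} \<le> sqrt b * e" if "\<And>i. i < b \<Longrightarrow> \<bar>f i - g i\<bar> \<le> e" for f g :: "nat \<Rightarrow> real"
  proof -
    have "L2_set (\<lambda>i. (f i - g i) + g i) {..<b} \<le> L2_set (\<lambda>i. f i - g i) {..<b} + L2_set g {..<b}"
      by (rule L2_set_triangle_ineq)
    moreover have "L2_set (\<lambda>i. \<bar>f i - g i\<bar>) {..<b} \<le> L2_set (\<lambda>i. e) {..<b}"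
      using that by (intro L2_set_mono) auto
    ultimately show ?thesis
      using e by (simp add: L2_set_constant) (simp add: L2_set_def)
  qed
  have "\<bar>L2_set x {..<b} - L2_set y {..<b}\<bar> \<le> sqrt b * e"
    using tri[of x y] tri[of y x] close by (auto simp: abs_le_iff abs_minus_commute)
  then have "sqrt (c / b) * \<bar>L2_set x {..<b} - L2_set y {..<b}\<bar> \<le> sqrt (c / b) * (sqrt b * e)"
    using c by (intro mult_left_mono) auto
  also have "\<dots> = sqrt c * e"
    using b by (simp add: real_sqrt_divide)
  also have "sqrt (c / b) * \<bar>L2_set x {..<b} - L2_set y {..<b}\<bar> =
      \<bar>sqrt (c / b) * L2_set x {..<b} - sqrt (c / b) * L2_set y {..<b}\<bar>"
    using c by (simp add: right_diff_distrib[symmetric] abs_mult)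
  finally show ?thesis
    by (simp only: L2_set_def real_sqrt_mult)
qed

text \<open>
  With \<open>r k\<close> the bound of strong invariance, \<open>sqrt k * r k\<close> is of order \<open>k powr (- \<delta>) * sqrt (ln k)\<close>
  and tends to \<open>0\<close>. Strong invariance covers offsets up to a fixed multiple of the batch size; this
  includes every batch, as offsets are at most \<open>n\<close> and \<open>n / m n\<close> is bounded (\<open>\<beta> > 0\<close>).
\<close>
lemma strong_approximation_vanishes:
  assumes beta: "(\<lambda>n. real (m n) / real n) \<longlonglongrightarrow> \<beta>" "0 < \<beta>" "\<beta> < 1" and sigma: "\<sigma> > 0" and delta: "\<delta> > 0"
    and tile: "\<forall>\<^sub>F n in sequentially. batches_tile n (m n) (d n) (b n)"
    and SI: "\<forall>K::nat. \<forall>\<^sub>F k in sequentially. \<forall>l\<le>K * k.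
        \<bar>(theta_hat est X (l + 1) (l + k) \<omega> - \<theta>) / \<sigma>
          - (W (real (l + k)) \<omega> - W (real l) \<omega>) / real k\<bar>
        \<le> \<Gamma> * real k powr (- 1/2 - \<delta>) * sqrt (ln (real k))"
    and W0: "W 0 \<omega> = 0"
  shows "(\<lambda>n. sqrt n * (sectioning est X n \<omega> - \<theta>) - \<sigma> * (W (real n) \<omega> / sqrt n)) \<longlonglongrightarrow> 0"
    and "(\<lambda>n. sqrt (sigma2_OB_I est X \<beta> n (m n) (d n) (b n) \<omega>)
      - \<sigma> * sqrt (walk_sigma2 \<beta> n (m n) (d n) (b n) (\<lambda>k. W (real k) \<omega>))) \<longlonglongrightarrow> 0"
proof -
  define r where "r k = \<Gamma> * real k powr (- 1/2 - \<delta>) * sqrt (ln (real k))" for k :: nat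
  have "(\<lambda>k. \<Gamma> * (sqrt (real k) * (real k powr (- 1/2 - \<delta>) * sqrt (ln (real k))))) \<longlonglongrightarrow> \<Gamma> * 0"
    using delta by (intro tendsto_mult_left) real_asymp
  then have r: "(\<lambda>k. sqrt k * r k) \<longlonglongrightarrow> 0"
    by (simp add: r_def mult_ac)
  have err: "\<bar>(t - \<theta>) - \<sigma> * s\<bar> \<le> \<sigma> * q" if "\<bar>(t - \<theta>) / \<sigma> - s\<bar> \<le> q" for t s q
  proof -
    have "(t - \<theta>) - \<sigma> * s = \<sigma> * ((t - \<theta>) / \<sigma> - s)"
      using sigma by (simp add: field_simps)
    then show ?thesis
      using that sigma by (simp add: abs_mult)
  qed
  have m_top: "filterlim m at_top sequentially"
  proof -
    have "filterlim (\<lambda>n. real (m n) / n * n) at_top sequentially"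
      by (rule filterlim_tendsto_pos_mult_at_top[OF beta(1,2) filterlim_real_sequentially])
    moreover have "\<forall>\<^sub>F n in sequentially. real (m n) / n * n = real (m n)"
      using eventually_gt_at_top[of 0] by eventually_elim simp
    ultimately have "filterlim (\<lambda>n. real (m n)) at_top sequentially"
      using filterlim_cong[OF refl refl] by fast
    then show ?thesis
      by (simp add: filterlim_sequentially_iff_filterlim_real)
  qed
  have whole: "\<forall>\<^sub>F n in sequentially. \<bar>(sectioning est X n \<omega> - \<theta>) - \<sigma> * (W (real n) \<omega> / n)\<bar> \<le> \<sigma> * r n"
    using spec[OF SI, of 0]
  proof eventually_elim
    case (elim n)
    then have "\<bar>(sectioning est X n \<omega> - \<theta>) / \<sigma> - W (real n) \<omega> / n\<bar> \<le> r n"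
      by (simp add: sectioning_def r_def W0)
    then show ?case by (rule err)
  qed
  (* Eventually m n / n > \<beta> / 2, so offsets up to n are at most 2 / \<beta> batch lengths. *)
  define K where "K = nat \<lceil>2 / \<beta>\<rceil>"
  have "\<forall>\<^sub>F k in sequentially. \<forall>l\<le>K * k. \<bar>(theta_hat est X (l + 1) (l + k) \<omega> - \<theta>)
      - \<sigma> * ((W (real (l + k)) \<omega> - W (real l) \<omega>) / real k)\<bar> \<le> \<sigma> * r k"
    using spec[OF SI, of K]
  proof eventually_elim
    case (elim k)
    then show ?case
      unfolding r_def by (intro allI impI err) blast
  qed
  from eventually_compose_filterlim[OF this m_top]
  have batch: "\<forall>\<^sub>F n in sequentially. \<forall>l\<le>K * m n. \<bar>(theta_hat est X (l + 1) (l + m n) \<omega> - \<theta>)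
      - \<sigma> * ((W (real (l + m n)) \<omega> - W (real l) \<omega>) / real (m n))\<bar> \<le> \<sigma> * r (m n)" .
  have n_le: "\<forall>\<^sub>F n in sequentially. n \<le> K * m n"
  proof -
    have "\<forall>\<^sub>F n in sequentially. \<beta> / 2 < m n / n"
      using beta by (intro order_tendstoD(1)[OF beta(1)]) auto
    then show ?thesis
      using eventually_gt_at_top[of 0]
    proof eventually_elim
      case (elim n)
      then have "real n \<le> 2 / \<beta> * m n"
        using beta by (simp add: field_simps)
      also have "\<dots> \<le> real K * m n"
        unfolding K_def by (intro mult_right_mono) (auto intro: real_nat_ceiling_ge)
      finally have "real n \<le> real (K * m n)" by simp
      then show ?case by linarith
    qed
  qed
  have "\<forall>\<^sub>F n in sequentially. norm (sqrt n * (sectioning est X n \<omega> - \<theta>) - \<sigma> * (W (real n) \<omega> / sqrt n)) \<le> \<sigma> * (sqrt n * r n)"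
    using whole eventually_gt_at_top[of 0]
  proof eventually_elim
    case (elim n)
    have "W (real n) \<omega> / sqrt n = sqrt n * (W (real n) \<omega> / n)"
      using elim by (simp add: field_simps)
    then have "sqrt n * (sectioning est X n \<omega> - \<theta>) - \<sigma> * (W (real n) \<omega> / sqrt n)
        = sqrt n * ((sectioning est X n \<omega> - \<theta>) - \<sigma> * (W (real n) \<omega> / n))"
      by (simp only:) (simp only: algebra_simps)
    then show ?case
      using mult_left_mono[OF elim(1), of "sqrt n"] by (simp add: abs_mult mult_ac)
  qed
  from Lim_null_comparison[OF this tendsto_mult_right_zero[OF r]]
  show "(\<lambda>n. sqrt n * (sectioning est X n \<omega> - \<theta>) - \<sigma> * (W (real n) \<omega> / sqrt n)) \<longlonglongrightarrow> 0" .

  have "\<forall>\<^sub>F n in sequentially. norm (sqrt (sigma2_OB_I est X \<beta> n (m n) (d n) (b n) \<omega>)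
      - \<sigma> * sqrt (walk_sigma2 \<beta> n (m n) (d n) (b n) (\<lambda>k. W (real k) \<omega>)))
      \<le> sqrt (1 / (1 - \<beta>)) * \<sigma> * (sqrt (m n) * r (m n) + sqrt (m n / n) * (sqrt n * r n))"
    using whole batch n_le tile eventually_gt_at_top[of 0]
  proof eventually_elim
    case (elim n)
    have b: "b n \<ge> 1"
      using elim by (auto simp: batches_tile_def)
    define c where "c = 1 / (1 - \<beta>) * m n"
    define x where "x i = theta_hat est X (i * d n + 1) (i * d n + m n) \<omega> - sectioning est X n \<omega>" for i
    define y where "y i = \<sigma> * ((W (real (i * d n + m n)) \<omega> - W (real (i * d n)) \<omega>) / m n - W (real n) \<omega> / n)" for i
    have "\<bar>x i - y i\<bar> \<le> \<sigma> * (r (m n) + r n)" if "i < b n" for i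
    proof -
      have "i * d n \<le> K * m n"
        using batches_tile_end[OF elim(4) that] elim(3) by linarith
      from elim(2)[rule_format, OF this] elim(1) show ?thesis
        unfolding x_def y_def right_diff_distrib distrib_left by linarith
    qed
    from root_mean_square_lipschitz[of c "b n", OF _ b this]
    have "\<bar>sqrt (c / b n * (\<Sum>i<b n. (x i)\<^sup>2)) - sqrt (c / b n * (\<Sum>i<b n. (y i)\<^sup>2))\<bar>
        \<le> sqrt c * (\<sigma> * (r (m n) + r n))"
      using beta by (simp add: c_def)
    also have "c / b n * (\<Sum>i<b n. (x i)\<^sup>2) = sigma2_OB_I est X \<beta> n (m n) (d n) (b n) \<omega>"
      by (simp add: c_def x_def sigma2_OB_I_def batch_estimator_def sum.atLeast1_atMost_eq)
    also have "sqrt (c / b n * (\<Sum>i<b n. (y i)\<^sup>2)) = \<sigma> * sqrt (walk_sigma2 \<beta> n (m n) (d n) (b n) (\<lambda>k. W (real k) \<omega>))"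
    proof -
      have "c / b n * (\<Sum>i<b n. (y i)\<^sup>2) = \<sigma>\<^sup>2 * walk_sigma2 \<beta> n (m n) (d n) (b n) (\<lambda>k. W (real k) \<omega>)"
        unfolding y_def power_mult_distrib sum_distrib_left[symmetric] walk_sigma2_def c_def
        by (simp add: mult_ac)
      then show ?thesis
        using sigma by (simp add: real_sqrt_mult)
    qed
    also have "sqrt c * (\<sigma> * (r (m n) + r n)) =
        sqrt (1 / (1 - \<beta>)) * \<sigma> * (sqrt (m n) * r (m n) + sqrt (m n / n) * (sqrt n * r n))"
    proof -
      have "sqrt (m n / n) * sqrt n = sqrt (m n)"
        using elim by (simp flip: real_sqrt_mult)
      then have *: "sqrt (m n / n) * (sqrt n * q) = sqrt (m n) * q" for q
        by (simp only: mult.assoc[symmetric])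
      show ?thesis
        unfolding c_def real_sqrt_mult * by (simp only: algebra_simps)
    qed
    finally show ?case by simp
  qed
  moreover have "(\<lambda>n. sqrt (1 / (1 - \<beta>)) * \<sigma> * (sqrt (m n) * r (m n) + sqrt (m n / n) * (sqrt n * r n)))
      \<longlonglongrightarrow> sqrt (1 / (1 - \<beta>)) * \<sigma> * (0 + sqrt \<beta> * 0)"
    by (intro tendsto_intros r beta filterlim_compose[OF r m_top])
  ultimately show "(\<lambda>n. sqrt (sigma2_OB_I est X \<beta> n (m n) (d n) (b n) \<omega>)
      - \<sigma> * sqrt (walk_sigma2 \<beta> n (m n) (d n) (b n) (\<lambda>k. W (real k) \<omega>))) \<longlonglongrightarrow> 0"
    by (auto intro: Lim_null_comparison)
qed

section \<open>The statistics as functionals of the observed process\<close>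

text \<open>
  An empty batch gives the constant \<open>est []\<close>, so measurability holds for all index ranges, and hence for
  the statistics at every \<open>n\<close>, including those for which the batch parameters do not fit together.
\<close>
lemma theta_hat_measurable:
  assumes est: "estimation_rule S est" and X: "\<And>j. j \<ge> 1 \<Longrightarrow> X j \<in> measurable M S" and l: "l \<ge> 1"
  shows "theta_hat est X l u \<in> borel_measurable M"
proof (cases "l \<le> u")
  case True
  define k where "k = u + 1 - l"
  have k: "k \<ge> 1" "u + 1 = l + k"
    using True by (auto simp: k_def)
  have "(\<lambda>\<omega>. est (map (\<lambda>i\<in>{..<k}. X (l + i) \<omega>) [0..<k])) \<in> borel_measurable M"
    using est k(1) l X
    by (intro measurable_compose[OF _ est[unfolded estimation_rule_def, rule_format, OF k(1)]] measurable_restrict) auto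
  also have "(\<lambda>\<omega>. est (map (\<lambda>i\<in>{..<k}. X (l + i) \<omega>) [0..<k])) = theta_hat est X l u"
    unfolding theta_hat_def k(2)
    by (intro ext arg_cong[where f = est] nth_equalityI) auto
  finally show ?thesis .
next
  case False
  then have "theta_hat est X l u = (\<lambda>_. est [])"
    by (auto simp: theta_hat_def)
  then show ?thesis by simp
qed

lemma theta_hat_cong:
  "(\<And>j. j \<ge> l \<Longrightarrow> X j \<omega> = Y j \<omega>') \<Longrightarrow> theta_hat est X l u \<omega> = theta_hat est Y l u \<omega>'"
  unfolding theta_hat_def by (intro arg_cong[where f = est] map_cong) auto

lemma OB_I_measurable:
  assumes "estimation_rule S est" "\<And>j. j \<ge> 1 \<Longrightarrow> X j \<in> measurable M S"
  shows "sectioning est X n \<in> borel_measurable M"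
    and "sigma2_OB_I est X \<beta> n m d b \<in> borel_measurable M"
    and "T_OB_I est X \<theta> \<beta> n m d b \<in> borel_measurable M"
proof -
  have [measurable]: "theta_hat est X (Suc l) u \<in> borel_measurable M" for l u
    using assms by (rule theta_hat_measurable) auto
  show [measurable]: "sectioning est X n \<in> borel_measurable M"
    by (simp add: sectioning_def)
  show [measurable]: "sigma2_OB_I est X \<beta> n m d b \<in> borel_measurable M"
    unfolding sigma2_OB_I_def[abs_def] batch_estimator_def by simp
  show "T_OB_I est X \<theta> \<beta> n m d b \<in> borel_measurable M"
    unfolding T_OB_I_def[abs_def] by simp
qed

lemma process_statistic_law:
  assumes X: "\<And>j. j \<ge> 1 \<Longrightarrow> X j \<in> measurable M S" "\<And>j. j \<ge> 1 \<Longrightarrow> X' j \<in> measurable N S"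
    and same_law: "process_law N S X' = process_law M S X"
    and F: "F \<in> borel_measurable (PiM {1..} (\<lambda>_. S))"
  shows "distr M borel (\<lambda>\<omega>. F (\<lambda>j\<in>{1..}. X j \<omega>)) = distr N borel (\<lambda>\<omega>. F (\<lambda>j\<in>{1..}. X' j \<omega>))"
proof -
  have *: "distr L borel (\<lambda>\<omega>. F (\<lambda>j\<in>{1..}. Y j \<omega>)) = distr (process_law L S Y) borel F"
    if "\<And>j. j \<ge> 1 \<Longrightarrow> Y j \<in> measurable L S" for L :: "'z measure" and Y
    unfolding process_law_def using that
    by (subst distr_distr[OF F]) (auto simp: comp_def intro!: measurable_restrict)
  show ?thesis
    by (simp only: *[OF X(1)] *[OF X(2)] same_law)
qed

text \<open>
  Both statistics are the same measurable functions of the observations, so they may be studied on the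
  probability space that carries the Wiener process of the strong approximation.
\<close>
lemma OB_I_law:
  fixes X :: "nat \<Rightarrow> 'a \<Rightarrow> 's" and X' :: "nat \<Rightarrow> 'c \<Rightarrow> 's"
  assumes est: "estimation_rule S est"
    and X: "\<And>j. j \<ge> 1 \<Longrightarrow> X j \<in> measurable M S" "\<And>j. j \<ge> 1 \<Longrightarrow> X' j \<in> measurable N S"
    and same_law: "process_law N S X' = process_law M S X"
  shows "distr M borel (sigma2_OB_I est X \<beta> n m d b) = distr N borel (sigma2_OB_I est X' \<beta> n m d b)"
    and "distr M borel (T_OB_I est X \<theta> \<beta> n m d b) = distr N borel (T_OB_I est X' \<theta> \<beta> n m d b)"
proof -
  let ?C = "\<lambda>j x. x j" and ?P = "PiM {1..} (\<lambda>_. S)"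
  have C: "?C j \<in> measurable ?P S" if "j \<ge> 1" for j :: nat
    using that by (intro measurable_component_singleton) auto
  have th: "theta_hat est ?C (l + 1) u (\<lambda>j\<in>{1..}. Y j \<omega>) = theta_hat est Y (l + 1) u \<omega>"
    "theta_hat est ?C 1 u (\<lambda>j\<in>{1..}. Y j \<omega>) = theta_hat est Y 1 u \<omega>" for Y :: "nat \<Rightarrow> 'z \<Rightarrow> 's" and \<omega> l u
    by (rule theta_hat_cong; simp)+
  have s: "sigma2_OB_I est ?C \<beta> n m d b (\<lambda>j\<in>{1..}. Y j \<omega>) = sigma2_OB_I est Y \<beta> n m d b \<omega>"
    and t: "T_OB_I est ?C \<theta> \<beta> n m d b (\<lambda>j\<in>{1..}. Y j \<omega>) = T_OB_I est Y \<theta> \<beta> n m d b \<omega>"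
    for Y :: "nat \<Rightarrow> 'z \<Rightarrow> 's" and \<omega>
    by (simp_all only: sigma2_OB_I_def T_OB_I_def batch_estimator_def sectioning_def th)
  have law: "distr M borel (\<lambda>\<omega>. F (\<lambda>j\<in>{1..}. X j \<omega>)) = distr N borel (\<lambda>\<omega>. F (\<lambda>j\<in>{1..}. X' j \<omega>))"
    if "F \<in> borel_measurable ?P" for F :: "(nat \<Rightarrow> 's) \<Rightarrow> real"
    by (rule process_statistic_law[OF _ _ same_law that]) (use X in auto)
  have meas: "sigma2_OB_I est ?C \<beta> n m d b \<in> borel_measurable ?P" "T_OB_I est ?C \<theta> \<beta> n m d b \<in> borel_measurable ?P"
    using OB_I_measurable[OF est C] by auto
  show "distr M borel (sigma2_OB_I est X \<beta> n m d b) = distr N borel (sigma2_OB_I est X' \<beta> n m d b)"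
    using law[OF meas(1)] by (simp only: s)
  show "distr M borel (T_OB_I est X \<theta> \<beta> n m d b) = distr N borel (T_OB_I est X' \<theta> \<beta> n m d b)"
    using law[OF meas(2)] by (simp only: t)
qed

section \<open>Limits of the variance estimator and of the studentized statistic\<close>

theorem theorem5p1:
  fixes M :: "'a measure" and S :: "'s measure" and X :: "nat \<Rightarrow> 'a \<Rightarrow> 's"
    and est :: "'s list \<Rightarrow> real" and \<theta> :: "(nat \<Rightarrow> 's) measure \<Rightarrow> real"
    and N :: "'c measure" and X' :: "nat \<Rightarrow> 'c \<Rightarrow> 's" and W' :: "real \<Rightarrow> 'c \<Rightarrow> real"
    and \<Gamma> :: "'c \<Rightarrow> real"
    and \<Omega> :: "'w measure" and W :: "real \<Rightarrow> 'w \<Rightarrow> real"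
    and m d b :: "nat \<Rightarrow> nat" and \<beta> \<sigma> \<delta> :: real and b_inf :: enat
    and P :: "(nat \<Rightarrow> 's) measure"
  assumes P: "P = process_law M S X"
    and X: "stationary_process M S X"
    and est: "estimation_rule S est"
    and sigma_pos: "\<sigma> > 0"
    and sigma: "(\<lambda>n. \<integral>\<omega>. (sqrt (real n) * (sectioning est X n \<omega> - \<theta> P))\<^sup>2 \<partial>M) \<longlonglongrightarrow> \<sigma>\<^sup>2"
    and X': "stationary_process N S X'"
    and same_law: "process_law N S X' = P"
    and W': "standard_wiener N W'"
    and SI: "strong_invariance N est X' W' (\<theta> P) \<sigma> \<delta> \<Gamma>"
    and batches: "\<forall>\<^sub>F n in sequentially. m n \<ge> 1 \<and> d n \<ge> 1 \<and> b n \<ge> 1 \<and>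
      real (d n) = (real n - real (m n)) / (real (b n) - 1)"
    and beta: "(\<lambda>n. real (m n) / real n) \<longlonglongrightarrow> \<beta>" "0 < \<beta>" "\<beta> < 1"
    and b_lim: "(\<lambda>n. enat (b n)) \<longlonglongrightarrow> b_inf" "b_inf \<ge> 2"
    and W: "standard_wiener \<Omega> W"
  shows "weak_conv_m (\<lambda>n. distr M borel (sigma2_OB_I est X \<beta> n (m n) (d n) (b n)))
           (distr \<Omega> borel (\<lambda>\<omega>. \<sigma>\<^sup>2 * chi2_OB_I W \<beta> b_inf \<omega>)) \<and>
         weak_conv_m (\<lambda>n. distr M borel (T_OB_I est X (\<theta> P) \<beta> n (m n) (d n) (b n)))
           (distr \<Omega> borel (\<lambda>\<omega>. W 1 \<omega> / sqrt (chi2_OB_I W \<beta> b_inf \<omega>)))"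
proof -
  interpret N: prob_space N
    using W' by (simp add: standard_wiener_def)
  interpret O: prob_space \<Omega>
    using W by (simp add: standard_wiener_def)
  have Xm: "X j \<in> measurable M S" and X'm: "X' j \<in> measurable N S" if "j \<ge> 1" for j
    using X X' that by (auto simp: stationary_process_def)
  have law: "process_law N S X' = process_law M S X"
    using P same_law by simp
  have tile: "\<forall>\<^sub>F n in sequentially. batches_tile n (m n) (d n) (b n)"
    using batches by eventually_elim (auto intro: batches_tile_if_offset)
  have Wm: "W t \<in> borel_measurable \<Omega>" and W'm: "W' t \<in> borel_measurable N" if "t \<ge> 0" for t
    using W W' that by (auto simp: standard_wiener_def)
  have cont: "continuous_on {0..} (\<lambda>t. W t \<omega>)" if "\<omega> \<in> space \<Omega>" for \<omega>
    using W that by (simp add: standard_wiener_def)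
  define Q where "Q n = walk_sigma2 \<beta> n (m n) (d n) (b n)" for n
  define U where "U n \<omega> = sqrt (real n) * (sectioning est X' n \<omega> - \<theta> P)" for n \<omega>
  define A where "A n = sigma2_OB_I est X' \<beta> n (m n) (d n) (b n)" for n
  define B where "B = chi2_OB_I W \<beta> b_inf"
  have Q_lim: "(\<lambda>n. Q n (\<lambda>k. W (1 / real n * real k) \<omega> / sqrt (1 / real n))) \<longlonglongrightarrow> B \<omega>"
    if "\<omega> \<in> space \<Omega>" for \<omega>
    unfolding Q_def B_def by (rule walk_sigma2_tendsto_chi2[of W \<omega>, OF cont[OF that] tile beta b_lim(1)])
  have Qm: "(\<lambda>\<omega>. Q n (\<lambda>k. W (1 / real n * real k) \<omega> / sqrt (1 / real n))) \<in> borel_measurable \<Omega>"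
    "(\<lambda>\<omega>. Q n (\<lambda>k. W' (real k) \<omega>)) \<in> borel_measurable N" for n
    unfolding Q_def by (intro walk_sigma2_measurable borel_measurable_divide Wm W'm; simp)+
  note [measurable] = Qm
  have [measurable]: "B \<in> borel_measurable \<Omega>"
    by (rule borel_measurable_LIMSEQ_real[OF Q_lim Qm(1)])
  have [measurable]: "A n \<in> borel_measurable N" "U n \<in> borel_measurable N" for n
    unfolding A_def U_def[abs_def] using OB_I_measurable[OF est X'm] by auto
  have [measurable]: "W 1 \<in> borel_measurable \<Omega>"
    by (rule Wm) simp
  have AE_pos: "AE \<omega> in \<Omega>. 0 < B \<omega>"
    using standard_wiener_bridge_nonzero[OF W beta(2,3)] AE_space
  proof eventually_elim
    case (elim \<omega>)
    then show ?case
      unfolding B_def by (intro chi2_OB_I_pos[of W \<omega>, OF cont beta(2,3) b_lim(2)])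
  qed
  have diff: "AE \<omega> in N. (\<lambda>n. U n \<omega> - \<sigma> * (W' (real n) \<omega> / sqrt n)) \<longlonglongrightarrow> 0 \<and>
      (\<lambda>n. sqrt (A n \<omega>) - \<sigma> * sqrt (Q n (\<lambda>k. W' (real k) \<omega>))) \<longlonglongrightarrow> 0"
  proof -
    have delta: "\<delta> > 0"
      using SI by (simp add: strong_invariance_def)
    have "AE \<omega> in N. W' 0 \<omega> = 0"
      using W' by (simp add: standard_wiener_def)
    moreover have "AE \<omega> in N. \<forall>K::nat. \<forall>\<^sub>F k in sequentially. \<forall>l\<le>K * k.
        \<bar>(theta_hat est X' (l + 1) (l + k) \<omega> - \<theta> P) / \<sigma>
          - (W' (real (l + k)) \<omega> - W' (real l) \<omega>) / real k\<bar>
        \<le> \<Gamma> \<omega> * real k powr (- 1/2 - \<delta>) * sqrt (ln (real k))"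
      using SI unfolding strong_invariance_def by blast
    ultimately show ?thesis
      unfolding U_def A_def Q_def
    proof eventually_elim
      case (elim \<omega>)
      then show ?case
        using strong_approximation_vanishes[of m \<beta> \<sigma> \<delta> d b est X' \<omega> "\<theta> P" W' "\<Gamma> \<omega>",
            OF beta sigma_pos delta tile] by blast
    qed
  qed
  (* Linear combinations of numerator and denominator suffice for both claims: the denominator alone
     gives the variance estimator, and U n - x * sqrt (A n) gives the distribution function of T. *)
  have joint: "weak_conv_m (\<lambda>n. distr N borel (\<lambda>\<omega>. p * U n \<omega> + q * sqrt (A n \<omega>)))
      (distr \<Omega> borel (\<lambda>\<omega>. p * (\<sigma> * W 1 \<omega>) + q * (\<sigma> * sqrt (B \<omega>))))" for p q
  proof -
    (* F n maps the walk behind the Wiener process, at integer times, to the approximating variable. *)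
    define F where "F n s = p * (\<sigma> * (s n / sqrt n)) + q * (\<sigma> * sqrt (Q n s))" for n s
    have F_law: "\<forall>\<^sub>F n in sequentially. distr N borel (\<lambda>\<omega>. F n (\<lambda>k. W' (real k) \<omega>)) =
        distr \<Omega> borel (\<lambda>\<omega>. F n (\<lambda>k. W (1 / real n * real k) \<omega> / sqrt (1 / real n)))"
      using tile eventually_gt_at_top[of 0]
    proof eventually_elim
      case (elim n)
      (* The law of the walk is available for its first n values only, and F n reads no others. *)
      have local: "F n (restrict s {..n}) = F n s" for s
        by (simp add: F_def Q_def walk_sigma2_local[OF elim(1)])
      have "(\<lambda>s. restrict s {..n} k) \<in> borel_measurable (PiM {..n} (\<lambda>_. borel :: real measure))" for k
        by (cases "k \<le> n") auto
      note [measurable] = this walk_sigma2_measurable[OF this]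
      have "(\<lambda>s. F n (restrict s {..n})) \<in> borel_measurable (PiM {..n} (\<lambda>_. borel))"
        unfolding F_def Q_def by measurable
      then have "F n \<in> borel_measurable (PiM {..n} (\<lambda>_. borel))"
        by (simp only: local)
      from standard_wiener_scaling_law[OF W' W _ _ _ this local, of 1 "1 / real n"] elim(2)
      show ?case by simp
    qed
    show ?thesis
    proof (rule weak_conv_by_coupling[OF N.prob_space_axioms O.prob_space_axioms _ _ _ _ F_law])
      show "(\<lambda>\<omega>. F n (\<lambda>k. W' (real k) \<omega>)) \<in> borel_measurable N"
        "(\<lambda>\<omega>. F n (\<lambda>k. W (1 / real n * real k) \<omega> / sqrt (1 / real n))) \<in> borel_measurable \<Omega>" for n
      proof -
        have "W (1 / real n * real n) \<in> borel_measurable \<Omega>" "W' (real n) \<in> borel_measurable N"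
          by (intro Wm W'm; simp)+
        note intros = this Qm[of n] borel_measurable_add borel_measurable_times borel_measurable_divide
          borel_measurable_const measurable_compose[OF _ borel_measurable_sqrt]
        show "(\<lambda>\<omega>. F n (\<lambda>k. W' (real k) \<omega>)) \<in> borel_measurable N"
          unfolding F_def by (intro intros)
        show "(\<lambda>\<omega>. F n (\<lambda>k. W (1 / real n * real k) \<omega> / sqrt (1 / real n))) \<in> borel_measurable \<Omega>"
          unfolding F_def by (intro intros)
      qed
      show "AE \<omega> in N. (\<lambda>n. p * U n \<omega> + q * sqrt (A n \<omega>) - F n (\<lambda>k. W' (real k) \<omega>)) \<longlonglongrightarrow> 0"
        using diff
      proof eventually_elim
        case (elim \<omega>)
        then have "(\<lambda>n. p * (U n \<omega> - \<sigma> * (W' (real n) \<omega> / sqrt n)) +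
            q * (sqrt (A n \<omega>) - \<sigma> * sqrt (Q n (\<lambda>k. W' (real k) \<omega>)))) \<longlonglongrightarrow> p * 0 + q * 0"
          by (intro tendsto_intros) auto
        then show ?case
          by (simp add: F_def algebra_simps)
      qed
      show "AE \<omega> in \<Omega>. (\<lambda>n. F n (\<lambda>k. W (1 / real n * real k) \<omega> / sqrt (1 / real n)))
          \<longlonglongrightarrow> p * (\<sigma> * W 1 \<omega>) + q * (\<sigma> * sqrt (B \<omega>))"
      proof (rule AE_I2)
        fix \<omega> assume \<omega>: "\<omega> \<in> space \<Omega>"
        have "\<forall>\<^sub>F n in sequentially. W 1 \<omega> = W (1 / real n * real n) \<omega> / sqrt (1 / real n) / sqrt n"
          using eventually_gt_at_top[of 0] by eventually_elim (simp add: real_sqrt_divide)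
        then have "(\<lambda>n. W (1 / real n * real n) \<omega> / sqrt (1 / real n) / sqrt n) \<longlonglongrightarrow> W 1 \<omega>"
          by (rule Lim_transform_eventually[OF tendsto_const])
        then show "(\<lambda>n. F n (\<lambda>k. W (1 / real n * real k) \<omega> / sqrt (1 / real n)))
          \<longlonglongrightarrow> p * (\<sigma> * W 1 \<omega>) + q * (\<sigma> * sqrt (B \<omega>))"
          unfolding F_def by (intro tendsto_intros Q_lim \<omega>)
      qed
    qed measurable
  qed
  show ?thesis
  proof
    have "weak_conv_m (\<lambda>n. distr N borel (A n)) (distr \<Omega> borel (\<lambda>\<omega>. \<sigma>\<^sup>2 * B \<omega>))"
    proof (rule weak_conv_of_sqrt[OF N.prob_space_axioms O.prob_space_axioms])
      show "weak_conv_m (\<lambda>n. distr N borel (\<lambda>\<omega>. sqrt (A n \<omega>)))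
          (distr \<Omega> borel (\<lambda>\<omega>. sqrt (\<sigma>\<^sup>2 * B \<omega>)))"
        using joint[of 0 1] sigma_pos by (simp add: real_sqrt_mult)
    qed measurable
    then show "weak_conv_m (\<lambda>n. distr M borel (sigma2_OB_I est X \<beta> n (m n) (d n) (b n)))
        (distr \<Omega> borel (\<lambda>\<omega>. \<sigma>\<^sup>2 * chi2_OB_I W \<beta> b_inf \<omega>))"
      by (simp only: A_def B_def OB_I_law(1)[OF est Xm X'm law])
    have "0 \<le> A n \<omega>" for n \<omega>
      unfolding A_def sigma2_OB_I_def using beta(3) by (intro mult_nonneg_nonneg sum_nonneg) auto
    then have A_nonneg: "0 \<le> sqrt (A n \<omega>)" for n \<omega>
      by simp
    have "weak_conv_m (\<lambda>n. distr N borel (\<lambda>\<omega>. U n \<omega> / sqrt (A n \<omega>)))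
        (distr \<Omega> borel (\<lambda>\<omega>. \<sigma> * W 1 \<omega> / (\<sigma> * sqrt (B \<omega>))))"
    proof (intro weak_conv_ratio joint N.prob_space_axioms O.prob_space_axioms)
      show "AE \<omega> in \<Omega>. 0 < \<sigma> * sqrt (B \<omega>)"
        using AE_pos by eventually_elim (simp add: sigma_pos)
    qed (measurable, rule A_nonneg)
    moreover have "\<sigma> * W 1 \<omega> / (\<sigma> * sqrt (B \<omega>)) = W 1 \<omega> / sqrt (B \<omega>)" for \<omega>
      using sigma_pos by simp
    moreover have "(\<lambda>\<omega>. U n \<omega> / sqrt (A n \<omega>)) = T_OB_I est X' (\<theta> P) \<beta> n (m n) (d n) (b n)" for n
      by (simp add: fun_eq_iff U_def A_def T_OB_I_def)
    ultimately show "weak_conv_m (\<lambda>n. distr M borel (T_OB_I est X (\<theta> P) \<beta> n (m n) (d n) (b n)))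
        (distr \<Omega> borel (\<lambda>\<omega>. W 1 \<omega> / sqrt (chi2_OB_I W \<beta> b_inf \<omega>)))"
      by (simp only: B_def OB_I_law(2)[OF est Xm X'm law])
  qed
qed

end
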